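(* Let $K$ be a field of characteristic $0$, let $W$ be the associative algebra generated by two generic traceless $2\times2$ matrices $x,y$ over $K$, let $\widehat W$ be its completion, and let $t=\mathrm{tr}(x^2)$, $u=\mathrm{tr}(y^2)$, $v=\mathrm{tr}(xy)$. Let $r\ge3$ be an integer, let $X=ax+by+c[x,y]$, $a,b,c\in K[[t,u,v]]$, be an element of $\widehat W$, and let $\mathrm{M}(\mathrm{ad}\,X)$ be the associated matrix of $\mathrm{ad}\,X$. Then the associated matrix $\mathrm{M}(\exp(\mathrm{ad}\,X))$ of the inner automorphism $\exp(\mathrm{ad}\,X)$ of $W/\omega(W)^{r+1}\cong\widehat W/\omega(\widehat W)^{r+1}$ is of the form $$\mathrm{M}(\exp(\mathrm{ad}\,X))=I_3+A(X)\,\mathrm{M}(\mathrm{ad}\,X)+B(X)\,\mathrm{M}^2(\mathrm{ad}\,X)\quad\left(\mathrm{mod}\ M_3(\omega^{[(r+1)/2]})\right),$$ $$A(X)=\frac{\sinh(\sqrt{g(X)})}{\sqrt{g(X)}},\qquad B(X)=\frac{\cosh(\sqrt{g(X)})-1}{g(X)},$$ where $$\mathrm{M}(\mathrm{ad}\,X)=\begin{pmatrix} -2cv & -2cu & 2(av+bu) \\ 2ct & 2cv & -2(at+bv) \\ b & -a & 0 \end{pmatrix},$$ $$g(X)=2\left(a^2t+2abv+b^2u+2c^2(v^2-tu)\right)$$ and $M_3(\omega^{[(r+1)/2]})$ is the $3\times3$ matrix algebra with entries from the $[(r+1)/2]$-th power of the augmentation ideal $\omega$ of $K[t,u,v]$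.
   Context: The generic traceless matrices are $x=\begin{pmatrix} x_{11} & x_{12} \\ x_{21} & -x_{11} \end{pmatrix}$, $y=\begin{pmatrix} y_{11} & y_{12} \\ y_{21} & -y_{11} \end{pmatrix}$ with $x_{11},x_{12},x_{21},y_{11},y_{12},y_{21}$ algebraically independent commuting variables; $W$ is the unital $K$-subalgebra of $M_2(K[x_{ij},y_{ij}])$ generated by $x,y$, polynomials being identified with scalar matrices. $W$ is graded by total degree in $x,y$; $\omega(W)$ is its augmentation ideal (elements with zero degree-$0$ component), so $\omega(W)^n$ is the span of homogeneous elements of degree $\ge n$. $\widehat W$ is the completion of $W$ in the formal power series topology, and $\omega(\widehat W)^n$ consists of the series with no components of degree less than $n$. The elements $t,u,v\in W$ are central, algebraically independent, of degree $2$, and $\widehat W$ is a free $K[[t,u,v]]$-module with basis $1,x,y,[x,y]$, where $[z_1,z_2]=z_1z_2-z_2z_1$. For $X\in\widehat W$, $\mathrm{ad}\,X$ acts by $z\,\mathrm{ad}\,X=[z,X]$ and $\exp(\mathrm{ad}\,X)=\sum_{n\ge0}\mathrm{ad}^nX/n!$; it induces an automorphism of $\widehat W/\omega(\widehat W)^{r+1}$. For a $K[[t,u,v]]$-endomorphism $\delta$ of the free submodule of $\widehat W$ with basis $\{x,y,[x,y]\}$, the associated matrix $\mathrm{M}(\delta)=(\sigma_{ij})\in M_3(K[[t,u,v]])$ has as columns the coordinates of the images: $\delta(x)=\sigma_{11}x+\sigma_{21}y+\sigma_{31}[x,y]$, $\delta(y)=\sigma_{12}x+\sigma_{22}y+\sigma_{32}[x,y]$,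 $\delta([x,y])=\sigma_{13}x+\sigma_{23}y+\sigma_{33}[x,y]$. For automorphisms of $W/\omega(W)^{r+1}$ the same equations are read for the images of $x,y,[x,y]$ in the quotient, with the entries $\sigma_{ij}$ taken in $K[t,u,v]/\omega^{[(r+1)/2]}$, which is identified with the quotient of $K[[t,u,v]]$ by the corresponding power of its augmentation ideal; $\omega$ is the ideal of polynomials in $K[t,u,v]$ without constant term and $[\,\cdot\,]$ in the exponent is the integer part. (Elements of $x\,\omega^{[(r+1)/2]}$, $y\,\omega^{[(r+1)/2]}$, $[x,y]\,\omega^{[(r+1)/2]}$ have degree at least $r+1$ in $W$, so vanish in the quotient.) $I_3$ is the $3\times3$ identity matrix. $A(X),B(X)$ are formal power series in $g(X)$: $\frac{\sinh\sqrt w}{\sqrt w}=\sum_{n\ge0}\frac{w^n}{(2n+1)!}$, $\frac{\cosh\sqrt w-1}{w}=\sum_{n\ge0}\frac{w^n}{(2n+2)!}$. *)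

theory Defs
  imports "HOL-Analysis.Analysis"
begin

section \<open>Formal power series in finitely many commuting variables\<close>

text \<open>
  The variables are the elements of a finite type; an exponent vector assigns a natural
  number to each of them.
\<close>

typedef ('v::finite, 'k) mps = "UNIV :: (nat ^ 'v \<Rightarrow> 'k) set"
  morphisms mps_coeff Abs_mps
  by simp

declare Abs_mps_inverse [simplified, simp]

lemma mps_eqI: "(\<And>m. mps_coeff f m = mps_coeff g m) \<Longrightarrow> f = g"
  by (metis ext mps_coeff_inject)

lemma finite_exponents_le: "finite {p :: nat ^ 'v. \<forall>i. p $ i \<le> m $ i}"
proof -
  have "vec_nth ` {p :: nat ^ 'v. \<forall>i. p $ i \<le> m $ i} \<subseteq> (\<Pi>\<^sub>E i\<in>UNIV. {..m $ i})"
    by auto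
  moreover have "finite (\<Pi>\<^sub>E i\<in>(UNIV :: 'v set). {..m $ i})"
    by (intro finite_PiE) auto
  ultimately show ?thesis
    by (metis (lifting) finite_subset finite_imageD injI inj_on_subset subset_UNIV vec_nth_inject)
qed

lemma finite_exponents_sum: "finite {(p, q). p + q = (m :: nat ^ 'v)}"
proof (rule finite_subset)
  let ?S = "{p :: nat ^ 'v. \<forall>i. p $ i \<le> m $ i}"
  show "{(p, q). p + q = m} \<subseteq> ?S \<times> ?S"
    by auto
  show "finite (?S \<times> ?S)"
    by (simp add: finite_exponents_le)
qed

instantiation mps :: (finite, comm_ring_1) comm_ring_1
begin

definition "0 = Abs_mps (\<lambda>_. 0)"
definition "1 = Abs_mps (\<lambda>m. if m = 0 then 1 else 0)"
definition "f + g = Abs_mps (\<lambda>m. mps_coeff f m + mps_coeff g m)"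
definition "f - g = Abs_mps (\<lambda>m. mps_coeff f m - mps_coeff g m)"
definition "- f = Abs_mps (\<lambda>m. - mps_coeff f m)"
definition "f * g = Abs_mps (\<lambda>m. \<Sum>(p, q)\<in>{(p, q). p + q = m}. mps_coeff f p * mps_coeff g q)"

lemma mps_coeff_0 [simp]: "mps_coeff 0 m = 0"
  and mps_coeff_1: "mps_coeff 1 m = (if m = 0 then 1 else 0)"
  and mps_coeff_add [simp]: "mps_coeff (f + g) m = mps_coeff f m + mps_coeff g m"
  and mps_coeff_diff [simp]: "mps_coeff (f - g) m = mps_coeff f m - mps_coeff g m"
  and mps_coeff_uminus [simp]: "mps_coeff (- f) m = - mps_coeff f m"
  and mps_coeff_mult:
    "mps_coeff (f * g) m = (\<Sum>(p, q)\<in>{(p, q). p + q = m}. mps_coeff f p * mps_coeff g q)"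
  for f g :: "('a, 'b) mps"
  by (simp_all add: zero_mps_def one_mps_def plus_mps_def minus_mps_def uminus_mps_def
      times_mps_def)

instance
proof
  fix f g h :: "('a, 'b) mps"
  show "f * g = g * f"
  proof (rule mps_eqI)
    fix m
    show "mps_coeff (f * g) m = mps_coeff (g * f) m"
      unfolding mps_coeff_mult
      by (rule sum.reindex_bij_witness[of _ prod.swap prod.swap])
        (auto simp: add.commute mult.commute)
  qed
  show "f * g * h = f * (g * h)"
  proof (rule mps_eqI)
    fix m
    let ?D = "\<lambda>m :: nat ^ 'a. {(p, q). p + q = m}"
    have "mps_coeff (f * g * h) m =
        (\<Sum>x\<in>?D m. \<Sum>y\<in>?D (fst x). mps_coeff f (fst y) * mps_coeff g (snd y) * mps_coeff h (snd x))"
      by (simp add: mps_coeff_mult sum_distrib_right case_prod_beta)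
    also have "\<dots> = (\<Sum>z\<in>(SIGMA x:?D m. ?D (fst x)).
        mps_coeff f (fst (snd z)) * mps_coeff g (snd (snd z)) * mps_coeff h (snd (fst z)))"
      by (subst sum.Sigma) (auto simp: finite_exponents_sum case_prod_beta)
    also have "\<dots> = (\<Sum>z\<in>(SIGMA x:?D m. ?D (snd x)).
        mps_coeff f (fst (fst z)) * mps_coeff g (fst (snd z)) * mps_coeff h (snd (snd z)))"
      by (rule sum.reindex_bij_witness[of _
            "\<lambda>((p, _), (q, s)). ((p + q, s), (p, q))" "\<lambda>((_, s), (p, q)). ((p, q + s), (q, s))"])
        (auto simp: add.assoc)
    also have "\<dots> =
        (\<Sum>x\<in>?D m. \<Sum>y\<in>?D (snd x). mps_coeff f (fst x) * (mps_coeff g (fst y) * mps_coeff h (snd y)))"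
      by (subst sum.Sigma) (auto simp: finite_exponents_sum case_prod_beta mult.assoc)
    also have "\<dots> = mps_coeff (f * (g * h)) m"
      by (simp add: mps_coeff_mult sum_distrib_left case_prod_beta)
    finally show "mps_coeff (f * g * h) m = mps_coeff (f * (g * h)) m" .
  qed
  show "1 * f = f"
  proof (rule mps_eqI)
    fix m
    have "mps_coeff (1 * f) m = (\<Sum>(p, q)\<in>{(0, m)}. mps_coeff 1 p * mps_coeff f q)"
      unfolding mps_coeff_mult
      by (rule sum.mono_neutral_right) (auto simp: finite_exponents_sum mps_coeff_1 split: if_splits)
    then show "mps_coeff (1 * f) m = mps_coeff f m"
      by (simp add: mps_coeff_1)
  qed
  show "(f + g) * h = f * h + g * h"
    by (rule mps_eqI) (simp add: mps_coeff_mult case_prod_beta distrib_right sum.distrib)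
  show "(0 :: ('a, 'b) mps) \<noteq> 1"
    by (metis mps_coeff_0 mps_coeff_1 zero_neq_one)
qed (auto intro!: mps_eqI)

end

definition mps_const :: "'k::zero \<Rightarrow> ('v::finite, 'k) mps" where
  "mps_const c = Abs_mps (\<lambda>m. if m = 0 then c else 0)"

definition mps_var :: "'v \<Rightarrow> ('v::finite, 'k::{zero,one}) mps" where
  "mps_var i = Abs_mps (\<lambda>m. if m = axis i 1 then 1 else 0)"

definition exp_degree :: "nat ^ 'v \<Rightarrow> nat" where
  "exp_degree m = (\<Sum>i\<in>UNIV. m $ i)"

definition mps_hom_component :: "nat \<Rightarrow> ('v::finite, 'k::zero) mps \<Rightarrow> ('v, 'k) mps" where
  "mps_hom_component d f = Abs_mps (\<lambda>m. if exp_degree m = d then mps_coeff f m else 0)"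

text \<open>
  Convergence in the formal power series topology: since there are only finitely many
  monomials of each degree, it is the same as stabilization of every coefficient.
\<close>

definition mps_sums :: "(nat \<Rightarrow> ('v::finite, 'k::comm_ring_1) mps) \<Rightarrow> ('v, 'k) mps \<Rightarrow> bool" where
  "mps_sums f s \<longleftrightarrow> (\<forall>m. \<exists>N. \<forall>n\<ge>N. mps_coeff (\<Sum>k<n. f k) m = mps_coeff s m)"

definition mps_suminf :: "(nat \<Rightarrow> ('v::finite, 'k::comm_ring_1) mps) \<Rightarrow> ('v, 'k) mps" where
  "mps_suminf f = (THE s. mps_sums f s)"

lemma mps_sums_unique: "mps_sums f s \<Longrightarrow> mps_suminf f = s"
  unfolding mps_suminf_def mps_sums_def
  by (rule the_equality) (auto intro!: mps_eqI, metis nat_le_linear)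

text \<open>The augmentation ideal (no constant term) and its powers as an ideal.\<close>

definition aug_ideal :: "('v::finite, 'k::comm_ring_1) mps set" where
  "aug_ideal = {f. mps_coeff f 0 = 0}"

inductive_set ideal_mult :: "'a::comm_ring_1 set \<Rightarrow> 'a set \<Rightarrow> 'a set"
  for I J :: "'a set" where
  zero: "0 \<in> ideal_mult I J"
| step: "h \<in> ideal_mult I J \<Longrightarrow> f \<in> I \<Longrightarrow> g \<in> J \<Longrightarrow> h + f * g \<in> ideal_mult I J"

primrec aug_power :: "nat \<Rightarrow> ('v::finite, 'k::comm_ring_1) mps set" where
  "aug_power 0 = UNIV"
| "aug_power (Suc n) = ideal_mult aug_ideal (aug_power n)"


section \<open>The algebra of two generic traceless matrices and its completion\<close>

datatype gen_var = X11 | X12 | X21 | Y11 | Y12 | Y21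

instance gen_var :: finite
proof
  have "(UNIV :: gen_var set) = {X11, X12, X21, Y11, Y12, Y21}"
    using gen_var.exhaust by auto
  then show "finite (UNIV :: gen_var set)"
    by (metis finite.emptyI finite_insert)
qed

text \<open>
  All matrices live in $M_2(K[[x_{ij},y_{ij}]])$, which contains both
  $M_2(K[x_{ij},y_{ij}])$ and its completion. Series are identified with scalar matrices
  through \<^const>\<open>mat\<close>.
\<close>

type_synonym 'k gen_matrix = "(gen_var, 'k) mps ^ 2 ^ 2"

definition gen_x :: "'k::comm_ring_1 gen_matrix" where
  "gen_x = vector [vector [mps_var X11, mps_var X12], vector [mps_var X21, - mps_var X11]]"

definition gen_y :: "'k::comm_ring_1 gen_matrix" where
  "gen_y = vector [vector [mps_var Y11, mps_var Y12], vector [mps_var Y21, - mps_var Y11]]"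

definition commutator :: "'k::comm_ring_1 gen_matrix \<Rightarrow> 'k gen_matrix \<Rightarrow> 'k gen_matrix" where
  "commutator z1 z2 = z1 ** z2 - z2 ** z1"

inductive_set alg_W :: "'k::comm_ring_1 gen_matrix set" where
  gen_x: "gen_x \<in> alg_W"
| gen_y: "gen_y \<in> alg_W"
| const: "mat (mps_const c) \<in> alg_W"
| add: "z1 \<in> alg_W \<Longrightarrow> z2 \<in> alg_W \<Longrightarrow> z1 + z2 \<in> alg_W"
| mult: "z1 \<in> alg_W \<Longrightarrow> z2 \<in> alg_W \<Longrightarrow> z1 ** z2 \<in> alg_W"

text \<open>
  As \<^term>\<open>gen_x\<close> and \<^term>\<open>gen_y\<close> have entries homogeneous of degree one, the
  degree in the generators is the degree of the entries.
\<close>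

definition hom_component :: "nat \<Rightarrow> 'k::comm_ring_1 gen_matrix \<Rightarrow> 'k gen_matrix" where
  "hom_component d Z = (\<chi> i j. mps_hom_component d (Z $ i $ j))"

definition W_hat :: "'k::comm_ring_1 gen_matrix set" where
  "W_hat = {Z. \<forall>d. hom_component d Z \<in> alg_W}"

definition omega_W_hat :: "nat \<Rightarrow> 'k::comm_ring_1 gen_matrix set" where
  "omega_W_hat n = {Z \<in> W_hat. \<forall>d<n. hom_component d Z = 0}"

definition ad :: "'k::comm_ring_1 gen_matrix \<Rightarrow> 'k gen_matrix \<Rightarrow> 'k gen_matrix" where
  "ad X z = commutator z X"

definition exp_ad :: "'k::field_char_0 gen_matrix \<Rightarrow> 'k gen_matrix \<Rightarrow> 'k gen_matrix" where
  "exp_ad X z =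
    (\<chi> i j. mps_suminf (\<lambda>n. mps_const (1 / fact n) * ((ad X ^^ n) z $ i $ j)))"


section \<open>Coordinates over $K[[t,u,v]]$\<close>

datatype tuv = Var_t | Var_u | Var_v

instance tuv :: finite
proof
  have "(UNIV :: tuv set) = {Var_t, Var_u, Var_v}"
    using tuv.exhaust by auto
  then show "finite (UNIV :: tuv set)"
    by (metis finite.emptyI finite_insert)
qed

type_synonym 'k tuv_series = "(tuv, 'k) mps"

text \<open>
  The embedding of $K[[t,u,v]]$ into the scalars: substitution of $\mathrm{tr}(x^2)$,
  $\mathrm{tr}(y^2)$, $\mathrm{tr}(xy)$ for the three variables, summed by degree.
\<close>

definition tuv_embed :: "'k::comm_ring_1 tuv_series \<Rightarrow> (gen_var, 'k) mps" where
  "tuv_embed f = mps_suminf (\<lambda>d. \<Sum>m | exp_degree m = d.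
     mps_const (mps_coeff f m) * trace (gen_x ** gen_x) ^ (m $ Var_t)
       * trace (gen_y ** gen_y) ^ (m $ Var_u) * trace (gen_x ** gen_y) ^ (m $ Var_v))"

definition lin_comb ::
  "'k::comm_ring_1 tuv_series \<Rightarrow> 'k tuv_series \<Rightarrow> 'k tuv_series \<Rightarrow> 'k gen_matrix" where
  "lin_comb a b c = mat (tuv_embed a) ** gen_x + mat (tuv_embed b) ** gen_y
     + mat (tuv_embed c) ** commutator gen_x gen_y"

definition is_assoc_matrix ::
  "('k::comm_ring_1 gen_matrix \<Rightarrow> 'k gen_matrix) \<Rightarrow> 'k tuv_series ^ 3 ^ 3 \<Rightarrow> bool" where
  "is_assoc_matrix \<delta> S \<longleftrightarrow>
     \<delta> gen_x = lin_comb (S $ 1 $ 1) (S $ 2 $ 1) (S $ 3 $ 1) \<and>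
     \<delta> gen_y = lin_comb (S $ 1 $ 2) (S $ 2 $ 2) (S $ 3 $ 2) \<and>
     \<delta> (commutator gen_x gen_y) = lin_comb (S $ 1 $ 3) (S $ 2 $ 3) (S $ 3 $ 3)"

definition assoc_matrix ::
  "('k::comm_ring_1 gen_matrix \<Rightarrow> 'k gen_matrix) \<Rightarrow> 'k tuv_series ^ 3 ^ 3" where
  "assoc_matrix \<delta> = (THE S. is_assoc_matrix \<delta> S)"

text \<open>
  The same equations read in the quotient of the completion by the \<open>n\<close>-th power of its
  augmentation ideal, for the map induced there by \<open>\<delta>\<close>.
\<close>

definition is_assoc_matrix_mod ::
  "nat \<Rightarrow> ('k::comm_ring_1 gen_matrix \<Rightarrow> 'k gen_matrix) \<Rightarrow> 'k tuv_series ^ 3 ^ 3 \<Rightarrow> bool" where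
  "is_assoc_matrix_mod n \<delta> S \<longleftrightarrow>
     \<delta> gen_x - lin_comb (S $ 1 $ 1) (S $ 2 $ 1) (S $ 3 $ 1) \<in> omega_W_hat n \<and>
     \<delta> gen_y - lin_comb (S $ 1 $ 2) (S $ 2 $ 2) (S $ 3 $ 2) \<in> omega_W_hat n \<and>
     \<delta> (commutator gen_x gen_y) - lin_comb (S $ 1 $ 3) (S $ 2 $ 3) (S $ 3 $ 3)
       \<in> omega_W_hat n"

definition mat3_cong ::
  "nat \<Rightarrow> 'k::comm_ring_1 tuv_series ^ 3 ^ 3 \<Rightarrow> 'k tuv_series ^ 3 ^ 3 \<Rightarrow> bool" where
  "mat3_cong n S S' \<longleftrightarrow> (\<forall>i j. S $ i $ j - S' $ i $ j \<in> aug_power n)"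

text \<open>
  $\sinh\sqrt w/\sqrt w$ and $(\cosh\sqrt w-1)/w$ as power series in \<open>w\<close>.
\<close>

definition sinhc_sqrt :: "'k::field_char_0 tuv_series \<Rightarrow> 'k tuv_series" where
  "sinhc_sqrt w = mps_suminf (\<lambda>n. mps_const (1 / fact (2 * n + 1)) * w ^ n)"

definition coshc_sqrt :: "'k::field_char_0 tuv_series \<Rightarrow> 'k tuv_series" where
  "coshc_sqrt w = mps_suminf (\<lambda>n. mps_const (1 / fact (2 * n + 2)) * w ^ n)"

end

theory Submission
  imports Defs
begin

text \<open>
  The formula is the Cayley--Hamilton theorem for the $3\times 3$ matrix $M$ of the derivation. The
  relations $[x,[x,y]] = 2ty - 2vx$ and $[y,[x,y]] = 2vy - 2ux$ show that the span of $x$, $y$, $[x,y]$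
  over $K[[t,u,v]]$ is stable under the derivation and give $M$ (\<open>ad_of_coords\<close>). Both the trace and the
  determinant of $M$ are zero, and half the trace of $M^2$ is $g$, so $M^3 = g M$
  (\<open>ad_matrix_cubed\<close>). The odd powers of $M$ are therefore $g^n M$ and the positive even ones $g^n M^2$, and
  the exponential series splits into $I_3 + A(X) M + B(X) M^2$ (\<open>exp_ad_matrix_sums\<close>). It converges
  because $g$ has no constant term. The embedding of $K[[t,u,v]]$ into the scalar
  matrices is a continuous ring homomorphism (\<open>tuv_embed_mult\<close>, \<open>mps_sums_tuv_embed\<close>), so the same formula
  describes the exponential of the derivation on the completion, with equality and not just a
  congruence (\<open>exp_ad_of_coords\<close>).

  For coordinates to be well defined, $x$, $y$, $[x,y]$ must be linearly independent over
  $K[[t,u,v]]$ (\<open>lin_comb_eq_0D\<close>). This is seen on the matrices with $x_{11} = y_{12} = 0$, where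
  the three traces become scalar multiples of independent monomials.

  The passage to the quotients is a count of degrees. The powers of the augmentation ideal of
  $K[[t,u,v]]$ are the steps of its degree filtration (\<open>aug_power_iff_order_ge\<close>). A component of
  degree $k$ of a coordinate sits in degree $2k + 1$ of the algebra at $x$ or $y$, and in degree
  $2k + 2$ at $[x,y]$. So a combination has no components of degree at most $r$ if and only if its first two
  coordinates have order at least $[(r+1)/2]$ and the third has order at least $[r/2]$
  (\<open>lin_comb_in_omega_W_hat_iff\<close>).
\<close>

section \<open>Monomials, homogeneous series and orders\<close>

lemma exp_degree_0 [simp]: "exp_degree (0 :: nat ^ 'v::finite) = 0"
  by (simp add: exp_degree_def)

lemma exp_degree_add [simp]: "exp_degree (p + q) = exp_degree p + exp_degree q"
  for p q :: "nat ^ 'v::finite"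
  by (simp add: exp_degree_def sum.distrib)

lemma exp_degree_axis [simp]: "exp_degree (axis i n :: nat ^ 'v::finite) = n"
  by (simp add: exp_degree_def axis_def)

lemma exp_degree_eq_0_iff [simp]: "exp_degree m = 0 \<longleftrightarrow> m = 0"
  for m :: "nat ^ 'v::finite"
  by (auto simp: exp_degree_def vec_eq_iff)

lemma finite_exp_degree_le [simp]: "finite {m :: nat ^ 'v::finite. exp_degree m \<le> n}"
proof (rule finite_subset)
  have "m $ i \<le> exp_degree m" for m :: "nat ^ 'v" and i
    unfolding exp_degree_def by (rule member_le_sum) auto
  then show "{m :: nat ^ 'v. exp_degree m \<le> n} \<subseteq> {p. \<forall>i. p $ i \<le> vec n $ i}"
    by (auto intro: le_trans)
qed (rule finite_exponents_le)

lemma finite_exp_degree_eq [simp]: "finite {m :: nat ^ 'v::finite. exp_degree m = n}"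
  by (rule finite_subset[OF _ finite_exp_degree_le[of n]]) auto

lemma mps_coeff_sum [simp]: "mps_coeff (sum f A) m = (\<Sum>a\<in>A. mps_coeff (f a) m)"
  by (induction A rule: infinite_finite_induct) auto

lemma mps_coeff_const: "mps_coeff (mps_const c) m = (if m = 0 then c else 0)"
  by (simp add: mps_const_def)

lemma mps_coeff_var: "mps_coeff (mps_var i) m = (if m = axis i 1 then 1 else 0)"
  by (simp add: mps_var_def)

definition mps_monom :: "nat ^ 'v \<Rightarrow> ('v::finite, 'k::comm_ring_1) mps" where
  "mps_monom p = Abs_mps (\<lambda>m. if m = p then 1 else 0)"

lemma mps_coeff_monom: "mps_coeff (mps_monom p) m = (if m = p then 1 else 0)"
  by (simp add: mps_monom_def)

lemma mps_var_eq_monom: "mps_var i = mps_monom (axis i 1)"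
  by (simp add: mps_var_def mps_monom_def)

lemma mps_coeff_monom_mult_add: "mps_coeff (mps_monom p * f) (p + q) = mps_coeff f q"
proof -
  have "mps_coeff (mps_monom p * f) (p + q) =
      (\<Sum>(p', q')\<in>{(p, q)}. mps_coeff (mps_monom p) p' * mps_coeff f q')"
    unfolding mps_coeff_mult
    by (rule sum.mono_neutral_right)
      (auto simp: finite_exponents_sum mps_coeff_monom split: if_splits)
  then show ?thesis
    by (simp add: mps_coeff_monom)
qed

lemma mps_coeff_monom_mult_eq_0:
  assumes "\<And>q. m \<noteq> p + q"
  shows "mps_coeff (mps_monom p * f) m = 0"
  unfolding mps_coeff_mult using assms
  by (intro sum.neutral) (auto simp: mps_coeff_monom)

lemma mps_monom_mult: "mps_monom p * mps_monom q = mps_monom (p + q)"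
proof (rule mps_eqI)
  fix m
  show "mps_coeff (mps_monom p * mps_monom q :: ('a, 'b) mps) m = mps_coeff (mps_monom (p + q)) m"
  proof (cases "\<exists>s. m = p + s")
    case True
    then show ?thesis by (auto simp: mps_coeff_monom_mult_add mps_coeff_monom)
  next
    case False
    then show ?thesis
      by (subst mps_coeff_monom_mult_eq_0) (auto simp: mps_coeff_monom)
  qed
qed

lemma mps_const_0 [simp]: "mps_const 0 = 0"
  and mps_const_1 [simp]: "mps_const 1 = 1"
  by (auto intro!: mps_eqI simp: mps_coeff_const mps_coeff_1)

lemma mps_coeff_const_mult [simp]: "mps_coeff (mps_const c * f) m = c * mps_coeff f m"
  for f :: "('v::finite, 'k::comm_ring_1) mps"
proof -
  have "mps_coeff (mps_const c * f) m = (\<Sum>(p, q)\<in>{(0 :: nat ^ 'v, m)}. mps_coeff (mps_const c) p * mps_coeff f q)"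
    unfolding mps_coeff_mult
    by (rule sum.mono_neutral_right)
      (auto simp: finite_exponents_sum mps_coeff_const split: if_splits)
  then show ?thesis
    by (simp add: mps_coeff_const)
qed

lemma mps_const_mult: "mps_const c * mps_const d = mps_const (c * d)"
  by (rule mps_eqI) (simp add: mps_coeff_const)

lemma mps_const_add: "mps_const c + mps_const d = mps_const (c + d)"
  by (rule mps_eqI) (simp add: mps_coeff_const)

lemma mps_const_uminus_1: "mps_const (- 1) = - 1"
  by (rule mps_eqI) (simp add: mps_coeff_const mps_coeff_1)


definition mps_homogeneous :: "nat \<Rightarrow> ('v::finite, 'k::comm_ring_1) mps \<Rightarrow> bool" where
  "mps_homogeneous d f \<longleftrightarrow> (\<forall>m. mps_coeff f m \<noteq> 0 \<longrightarrow> exp_degree m = d)"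

lemma mps_homogeneous_add:
  "mps_homogeneous d f \<Longrightarrow> mps_homogeneous d g \<Longrightarrow> mps_homogeneous d (f + g)"
  unfolding mps_homogeneous_def by (metis add_0 mps_coeff_add)

lemma mps_homogeneous_uminus: "mps_homogeneous d f \<Longrightarrow> mps_homogeneous d (- f)"
  unfolding mps_homogeneous_def by simp

lemma mps_homogeneous_var: "mps_homogeneous 1 (mps_var i)"
  unfolding mps_homogeneous_def by (simp add: mps_coeff_var)

lemma mps_homogeneous_1: "mps_homogeneous 0 1"
  unfolding mps_homogeneous_def by (simp add: mps_coeff_1)

lemma mps_homogeneous_mult:
  assumes "mps_homogeneous d f" "mps_homogeneous e g"
  shows "mps_homogeneous (d + e) (f * g)"
  unfolding mps_homogeneous_def
proof (intro allI impI)
  fix m assume "mps_coeff (f * g) m \<noteq> 0"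
  then obtain x where x: "x \<in> {(p, q). p + q = m}"
      "(case x of (p, q) \<Rightarrow> mps_coeff f p * mps_coeff g q) \<noteq> 0"
    unfolding mps_coeff_mult by (rule sum.not_neutral_contains_not_neutral)
  then have "mps_coeff f (fst x) \<noteq> 0" "mps_coeff g (snd x) \<noteq> 0"
    by (auto simp: case_prod_beta)
  then have "exp_degree (fst x) = d" "exp_degree (snd x) = e"
    using assms unfolding mps_homogeneous_def by blast+
  then show "exp_degree m = d + e"
    using x(1) by auto
qed

lemma mps_homogeneous_power: "mps_homogeneous d f \<Longrightarrow> mps_homogeneous (n * d) (f ^ n)"
  by (induction n) (auto intro: mps_homogeneous_1 mps_homogeneous_mult)

lemma mps_coeff_hom_component:
  "mps_coeff (mps_hom_component d f) m = (if exp_degree m = d then mps_coeff f m else 0)"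
  by (simp add: mps_hom_component_def)

lemma mps_hom_component_add:
  "mps_hom_component d (f + g) = mps_hom_component d f + mps_hom_component d g"
  by (rule mps_eqI) (simp add: mps_coeff_hom_component)

text \<open>
  A homogeneous factor only shifts the grading.
\<close>

lemma mps_hom_component_mult_homogeneous:
  assumes "mps_homogeneous e g"
  shows "mps_hom_component d (f * g) = (if e \<le> d then mps_hom_component (d - e) f * g else 0)"
proof (rule mps_eqI)
  fix m
  have "(if exp_degree m = d then mps_coeff f p * mps_coeff g q else 0) =
      (if e \<le> d \<and> exp_degree p = d - e then mps_coeff f p * mps_coeff g q else 0)"
    if "p + q = m" for p q
  proof (cases "exp_degree q = e")
    case True
    then show ?thesis using that by auto
  next
    case False
    then have "mps_coeff g q = 0"
      using assms unfolding mps_homogeneous_def by blast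
    then show ?thesis by simp
  qed
  then have "(\<Sum>(p, q)\<in>{(p, q). p + q = m}.
        if exp_degree m = d then mps_coeff f p * mps_coeff g q else 0) =
      (\<Sum>(p, q)\<in>{(p, q). p + q = m}.
        if e \<le> d \<and> exp_degree p = d - e then mps_coeff f p * mps_coeff g q else 0)"
    by (intro sum.cong) auto
  moreover have "mps_coeff (mps_hom_component d (f * g)) m =
      (\<Sum>(p, q)\<in>{(p, q). p + q = m}.
        if exp_degree m = d then mps_coeff f p * mps_coeff g q else 0)"
    by (simp add: mps_coeff_hom_component mps_coeff_mult case_prod_beta)
  moreover have "mps_coeff (if e \<le> d then mps_hom_component (d - e) f * g else 0) m =
      (\<Sum>(p, q)\<in>{(p, q). p + q = m}.
        if e \<le> d \<and> exp_degree p = d - e then mps_coeff f p * mps_coeff g q else 0)"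
  proof (cases "e \<le> d")
    case True
    then show ?thesis
      by (auto simp: mps_coeff_mult mps_coeff_hom_component case_prod_beta intro!: sum.cong)
  qed simp
  ultimately show "mps_coeff (mps_hom_component d (f * g)) m =
      mps_coeff (if e \<le> d then mps_hom_component (d - e) f * g else 0) m"
    by simp
qed


definition mps_order_ge :: "nat \<Rightarrow> ('v::finite, 'k::comm_ring_1) mps \<Rightarrow> bool" where
  "mps_order_ge n f \<longleftrightarrow> (\<forall>m. exp_degree m < n \<longrightarrow> mps_coeff f m = 0)"

lemma mps_order_ge_0 [simp]: "mps_order_ge 0 f"
  and mps_order_ge_zero [simp]: "mps_order_ge n 0"
  by (simp_all add: mps_order_ge_def)

lemma mps_order_ge_mono: "mps_order_ge n f \<Longrightarrow> k \<le> n \<Longrightarrow> mps_order_ge k f"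
  by (auto simp: mps_order_ge_def)

lemma mps_order_ge_add: "mps_order_ge n f \<Longrightarrow> mps_order_ge n g \<Longrightarrow> mps_order_ge n (f + g)"
  by (auto simp: mps_order_ge_def)

lemma mps_order_ge_mult:
  assumes "mps_order_ge k f" "mps_order_ge n g"
  shows "mps_order_ge (k + n) (f * g)"
  unfolding mps_order_ge_def
proof (intro allI impI)
  fix m :: "nat ^ 'a" assume m: "exp_degree m < k + n"
  have "mps_coeff f p * mps_coeff g q = 0" if "p + q = m" for p q
  proof -
    have "exp_degree p < k \<or> exp_degree q < n"
      using m that by auto
    then show ?thesis
      using assms by (auto simp: mps_order_ge_def)
  qed
  then show "mps_coeff (f * g) m = 0"
    unfolding mps_coeff_mult by (intro sum.neutral) auto
qed

lemma mps_order_ge_power: "mps_order_ge 1 f \<Longrightarrow> mps_order_ge n (f ^ n)"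
proof (induction n)
  case (Suc n)
  then show ?case using mps_order_ge_mult[of 1 f n "f ^ n"] by simp
qed simp

lemma mps_order_ge_sum: "(\<And>a. a \<in> A \<Longrightarrow> mps_order_ge n (f a)) \<Longrightarrow> mps_order_ge n (sum f A)"
  by (simp add: mps_order_ge_def)

lemma mps_homogeneous_order_ge: "mps_homogeneous d f \<Longrightarrow> mps_order_ge d f"
  unfolding mps_homogeneous_def mps_order_ge_def by auto

lemma aug_ideal_iff_order_ge: "f \<in> aug_ideal \<longleftrightarrow> mps_order_ge 1 f"
  by (simp add: aug_ideal_def mps_order_ge_def)

lemma sum_mem_ideal_mult:
  assumes "finite A" "\<And>a. a \<in> A \<Longrightarrow> f a \<in> I" "\<And>a. a \<in> A \<Longrightarrow> g a \<in> J"
  shows "(\<Sum>a\<in>A. f a * g a) \<in> ideal_mult I J"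
  using assms
  by (induction A rule: finite_induct)
    (auto intro: ideal_mult.zero simp: add.commute[of "f _ * g _"] intro!: ideal_mult.step)

text \<open>
  The choice of one variable for each monomial splits a series without constant term into multiples
  of the single variables.
\<close>

definition first_var :: "nat ^ 'v \<Rightarrow> 'v::finite" where
  "first_var m = (SOME i. m $ i \<noteq> 0)"

lemma first_var: "m \<noteq> 0 \<Longrightarrow> m $ first_var m \<noteq> 0"
  unfolding first_var_def by (rule someI_ex) (auto simp: vec_eq_iff)

text \<open>
  Every monomial of positive degree is divided by its chosen variable, which lowers the order by
  one.
\<close>

lemma mps_order_ge_Suc_decompose:
  assumes "mps_order_ge (Suc n) f"
  obtains h where "\<And>i. mps_order_ge n (h i)" and "f = (\<Sum>i\<in>UNIV. mps_var i * h i)"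
proof
  define h where "h i = Abs_mps (\<lambda>m.
      if first_var (m + axis i 1) = i then mps_coeff f (m + axis i 1) else 0)" for i
  show "mps_order_ge n (h i)" for i
    using assms by (auto simp: mps_order_ge_def h_def)
  show "f = (\<Sum>i\<in>UNIV. mps_var i * h i)"
  proof (rule mps_eqI)
    fix m
    have summand: "mps_coeff (mps_var i * h i) m =
        (if m \<noteq> 0 \<and> first_var m = i then mps_coeff f m else 0)" for i
    proof (cases "m $ i = 0")
      case True
      then have "mps_coeff (mps_var i * h i) m = 0"
        unfolding mps_var_eq_monom by (intro mps_coeff_monom_mult_eq_0) (auto simp: axis_def)
      then show ?thesis
        using True first_var[of m] by auto
    next
      case False
      then have m: "m = axis i 1 + (m - axis i 1)"
        by (auto simp: vec_eq_iff axis_def)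
      have "mps_coeff (mps_var i * h i) m = mps_coeff (h i) (m - axis i 1)"
        unfolding mps_var_eq_monom by (subst m, rule mps_coeff_monom_mult_add)
      moreover have "m - axis i 1 + axis i 1 = m"
        using m by (simp add: add.commute)
      ultimately show ?thesis
        using False by (auto simp: h_def)
    qed
    have "mps_coeff f 0 = 0"
      using assms by (simp add: mps_order_ge_def)
    then show "mps_coeff f m = mps_coeff (\<Sum>i\<in>UNIV. mps_var i * h i) m"
      unfolding mps_coeff_sum summand by (cases "m = 0") (simp_all del: One_nat_def)
  qed
qed

text \<open>
  A product of $n$ series without constant term starts in degree $n$. Conversely, a series of order
  $n + 1$ is the sum over the variables of a variable times a series of order $n$, so the
  ideal powers are exactly the steps of the degree filtration.
\<close>

lemma aug_power_iff_order_ge: "f \<in> aug_power n \<longleftrightarrow> mps_order_ge n f"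
proof (induction n arbitrary: f)
  case (Suc n)
  show ?case
  proof
    assume "f \<in> aug_power (Suc n)"
    then have "f \<in> ideal_mult aug_ideal (aug_power n)"
      by simp
    then show "mps_order_ge (Suc n) f"
    proof induction
      case (step h f g)
      then show ?case
        using mps_order_ge_mult[of 1 f n g] Suc.IH
        by (auto simp: aug_ideal_iff_order_ge intro: mps_order_ge_add)
    qed simp
  next
    assume "mps_order_ge (Suc n) f"
    then obtain h where "\<And>i. mps_order_ge n (h i)" "f = (\<Sum>i\<in>UNIV. mps_var i * h i)"
      using mps_order_ge_Suc_decompose by blast
    then show "f \<in> aug_power (Suc n)"
      by (auto simp: Suc.IH aug_ideal_iff_order_ge mps_homogeneous_order_ge mps_homogeneous_var[simplified]
          intro!: sum_mem_ideal_mult)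
  qed
qed simp

section \<open>Convergent sums of power series\<close>

lemma mps_sums_order_ge:
  fixes f :: "nat \<Rightarrow> ('v::finite, 'k::comm_ring_1) mps"
  assumes "\<And>n. mps_order_ge n (f n)"
  shows "\<exists>s. mps_sums f s"
proof
  show "mps_sums f (Abs_mps (\<lambda>m. \<Sum>k\<le>exp_degree m. mps_coeff (f k) m))"
    unfolding mps_sums_def
  proof (intro allI exI impI)
    fix m :: "nat ^ 'v" and n :: nat assume "Suc (exp_degree m) \<le> n"
    then have "(\<Sum>k<n. mps_coeff (f k) m) = (\<Sum>k\<le>exp_degree m. mps_coeff (f k) m)"
      using assms by (intro sum.mono_neutral_right) (auto simp: mps_order_ge_def)
    then show "mps_coeff (sum f {..<n}) m =
        mps_coeff (Abs_mps (\<lambda>m. \<Sum>k\<le>exp_degree m. mps_coeff (f k) m)) m"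
      by simp
  qed
qed

lemma mps_sums_suminf:
  assumes "\<And>n. mps_order_ge n (f n)"
  shows "mps_sums f (mps_suminf f)"
  using mps_sums_order_ge[OF assms] mps_sums_unique by blast

text \<open>
  Each coefficient stabilizes separately; for finitely many of them there is a common index
  after which all are stable.
\<close>

lemma mps_sums_uniform:
  assumes "mps_sums f s" "finite P"
  shows "\<exists>N. \<forall>n\<ge>N. \<forall>p\<in>P. mps_coeff (\<Sum>k<n. f k) p = mps_coeff s p"
proof -
  have "eventually (\<lambda>n. mps_coeff (\<Sum>k<n. f k) p = mps_coeff s p) sequentially" for p
    using assms(1) unfolding mps_sums_def eventually_sequentially by blast
  then have "eventually (\<lambda>n. \<forall>p\<in>P. mps_coeff (\<Sum>k<n. f k) p = mps_coeff s p) sequentially"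
    using assms(2) by (simp add: eventually_ball_finite)
  then show ?thesis
    unfolding eventually_sequentially .
qed

text \<open>
  The hypothesis on \<open>\<Phi>\<close> is continuity: a coefficient of the image depends only on finitely
  many coefficients of the argument, which are all stable from some index on.
\<close>

lemma mps_sums_continuous:
  assumes "mps_sums f s"
    and add: "\<And>n. \<Phi> (\<Sum>k<n. f k) = (\<Sum>k<n. \<Phi> (f k))"
    and dep: "\<And>m. \<exists>P. finite P \<and> (\<forall>h h'. (\<forall>p\<in>P. mps_coeff h p = mps_coeff h' p) \<longrightarrow>
      mps_coeff (\<Phi> h) m = mps_coeff (\<Phi> h') m)"
  shows "mps_sums (\<lambda>n. \<Phi> (f n)) (\<Phi> s)"
  unfolding mps_sums_def
proof
  fix m
  obtain P where "finite P" and P: "\<And>h h'. (\<And>p. p \<in> P \<Longrightarrow> mps_coeff h p = mps_coeff h' p) \<Longrightarrow>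
      mps_coeff (\<Phi> h) m = mps_coeff (\<Phi> h') m"
    using dep[of m] by blast
  then obtain N where "\<forall>n\<ge>N. \<forall>p\<in>P. mps_coeff (\<Sum>k<n. f k) p = mps_coeff s p"
    using mps_sums_uniform[OF assms(1)] by blast
  then have "\<forall>n\<ge>N. mps_coeff (\<Phi> (\<Sum>k<n. f k)) m = mps_coeff (\<Phi> s) m"
    using P by blast
  then show "\<exists>N. \<forall>n\<ge>N. mps_coeff (\<Sum>k<n. \<Phi> (f k)) m = mps_coeff (\<Phi> s) m"
    unfolding add by blast
qed

lemma mps_sums_mult: "mps_sums f s \<Longrightarrow> mps_sums (\<lambda>n. f n * h) (s * h)"
  for f :: "nat \<Rightarrow> ('v::finite, 'k::comm_ring_1) mps"
proof (erule mps_sums_continuous[where \<Phi> = "\<lambda>f. f * h"])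
  fix m :: "nat ^ 'v"
  let ?D = "{(p, q). p + q = m}"
  have "mps_coeff (f * h) m = mps_coeff (g * h) m"
    if "\<forall>p\<in>fst ` ?D. mps_coeff f p = mps_coeff g p" for f g
    unfolding mps_coeff_mult
  proof (rule sum.cong[OF refl])
    fix z assume "z \<in> ?D"
    then have "mps_coeff f (fst z) = mps_coeff g (fst z)"
      using that by blast
    then show "(case z of (p, q) \<Rightarrow> mps_coeff f p * mps_coeff h q) =
        (case z of (p, q) \<Rightarrow> mps_coeff g p * mps_coeff h q)"
      by (simp add: case_prod_beta)
  qed
  then show "\<exists>P. finite P \<and> (\<forall>f g. (\<forall>p\<in>P. mps_coeff f p = mps_coeff g p) \<longrightarrow>
      mps_coeff (f * h) m = mps_coeff (g * h) m)"
    using finite_imageI[OF finite_exponents_sum] by blast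
qed (simp add: sum_distrib_right)

lemma mps_sums_add:
  assumes "mps_sums f s" "mps_sums g s'"
  shows "mps_sums (\<lambda>n. f n + g n) (s + s')"
  unfolding mps_sums_def
proof
  fix m
  obtain N N' where "\<forall>n\<ge>N. mps_coeff (\<Sum>k<n. f k) m = mps_coeff s m"
      "\<forall>n\<ge>N'. mps_coeff (\<Sum>k<n. g k) m = mps_coeff s' m"
    using assms unfolding mps_sums_def by blast
  then show "\<exists>N. \<forall>n\<ge>N. mps_coeff (\<Sum>k<n. f k + g k) m = mps_coeff (s + s') m"
    by (intro exI[of _ "max N N'"]) (simp add: sum.distrib)
qed

lemma mps_sums_Suc:
  assumes "mps_sums (\<lambda>n. f (Suc n)) s"
  shows "mps_sums f (f 0 + s)"
  unfolding mps_sums_def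
proof
  fix m
  obtain N where N: "\<And>n. n \<ge> N \<Longrightarrow> mps_coeff (\<Sum>k<n. f (Suc k)) m = mps_coeff s m"
    using assms unfolding mps_sums_def by blast
  have "mps_coeff (\<Sum>k<n. f k) m = mps_coeff (f 0 + s) m" if "n \<ge> Suc N" for n
  proof -
    obtain n' where "n = Suc n'" "n' \<ge> N"
      using \<open>n \<ge> Suc N\<close> by (cases n) auto
    then show ?thesis
      using N[of n'] by (simp only: sum.lessThan_Suc_shift mps_coeff_add)
  qed
  then show "\<exists>N. \<forall>n\<ge>N. mps_coeff (\<Sum>k<n. f k) m = mps_coeff (f 0 + s) m"
    by blast
qed

text \<open>
  The sine-like and the cosine-like half of an exponential series are summed separately and
  then interleaved.
\<close>

lemma mps_sums_even_odd:
  assumes "mps_sums (\<lambda>n. f (2 * n)) s" "mps_sums (\<lambda>n. f (2 * n + 1)) s'"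
  shows "mps_sums f (s + s')"
  unfolding mps_sums_def
proof
  fix m
  obtain N N' where N: "\<And>n. n \<ge> N \<Longrightarrow> mps_coeff (\<Sum>k<n. f (2 * k)) m = mps_coeff s m"
      "\<And>n. n \<ge> N' \<Longrightarrow> mps_coeff (\<Sum>k<n. f (2 * k + 1)) m = mps_coeff s' m"
    using assms unfolding mps_sums_def by blast
  have split: "(\<Sum>k<n. f k) = (\<Sum>k<(n + 1) div 2. f (2 * k)) + (\<Sum>k<n div 2. f (2 * k + 1))" for n
  proof (induction n)
    case (Suc n)
    show ?case
    proof (cases "even n")
      case True
      then obtain k where "n = 2 * k" by blast
      then show ?thesis using Suc by (simp add: algebra_simps)
    next
      case False
      then obtain k where "n = 2 * k + 1" by (auto elim: oddE)
      then show ?thesis using Suc by (simp add: algebra_simps)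
    qed
  qed simp
  have "mps_coeff (\<Sum>k<n. f k) m = mps_coeff (s + s') m" if "n \<ge> 2 * max N N'" for n
    unfolding split mps_coeff_add using that by (intro arg_cong2[of _ _ _ _ "(+)"] N) auto
  then show "\<exists>N. \<forall>n\<ge>N. mps_coeff (\<Sum>k<n. f k) m = mps_coeff (s + s') m"
    by blast
qed


section \<open>The embedding of $K[[t,u,v]]$ is a continuous graded ring homomorphism\<close>

abbreviation gen_t :: "(gen_var, 'k::comm_ring_1) mps" where "gen_t \<equiv> trace (gen_x ** gen_x)"
abbreviation gen_u :: "(gen_var, 'k::comm_ring_1) mps" where "gen_u \<equiv> trace (gen_y ** gen_y)"
abbreviation gen_v :: "(gen_var, 'k::comm_ring_1) mps" where "gen_v \<equiv> trace (gen_x ** gen_y)"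

lemma gen_t_eq: "gen_t = 2 * (mps_var X11 * mps_var X11 + mps_var X12 * mps_var X21)"
  and gen_u_eq: "gen_u = 2 * (mps_var Y11 * mps_var Y11 + mps_var Y12 * mps_var Y21)"
  and gen_v_eq: "gen_v = 2 * (mps_var X11 * mps_var Y11) + mps_var X12 * mps_var Y21
    + mps_var X21 * mps_var Y12"
  by (simp_all add: trace_def gen_x_def gen_y_def matrix_matrix_mult_def sum_2 algebra_simps)

definition tuv_monom :: "nat ^ tuv \<Rightarrow> (gen_var, 'k::comm_ring_1) mps" where
  "tuv_monom p = gen_t ^ (p $ Var_t) * gen_u ^ (p $ Var_u) * gen_v ^ (p $ Var_v)"

lemma tuv_monom_0 [simp]: "tuv_monom 0 = 1"
  by (simp add: tuv_monom_def)

lemma tuv_monom_add: "tuv_monom (p + q) = tuv_monom p * tuv_monom q"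
  by (simp add: tuv_monom_def power_add algebra_simps)

lemma UNIV_tuv: "UNIV = {Var_t, Var_u, Var_v}"
  using tuv.exhaust by auto

lemma exp_degree_tuv: "exp_degree (p :: nat ^ tuv) = p $ Var_t + p $ Var_u + p $ Var_v"
  by (simp add: exp_degree_def UNIV_tuv)

lemma mps_homogeneous_tuv_gens:
  "mps_homogeneous 2 (gen_t :: (gen_var, 'k::comm_ring_1) mps)"
  "mps_homogeneous 2 (gen_u :: (gen_var, 'k) mps)"
  "mps_homogeneous 2 (gen_v :: (gen_var, 'k) mps)"
proof -
  have h: "mps_homogeneous 2 (mps_var i * mps_var j :: (gen_var, 'k) mps)" for i j
    using mps_homogeneous_mult[OF mps_homogeneous_var[of i] mps_homogeneous_var[of j]]
    by (simp add: numeral_2_eq_2)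
  show "mps_homogeneous 2 (gen_t :: (gen_var, 'k) mps)" "mps_homogeneous 2 (gen_u :: (gen_var, 'k) mps)"
      "mps_homogeneous 2 (gen_v :: (gen_var, 'k) mps)"
    unfolding gen_t_eq gen_u_eq gen_v_eq mult.assoc mult_2
    by (intro mps_homogeneous_add h)+
qed

lemma mps_homogeneous_tuv_monom: "mps_homogeneous (2 * exp_degree p) (tuv_monom p)"
proof -
  have "mps_homogeneous (p $ Var_t * 2 + p $ Var_u * 2 + p $ Var_v * 2) (tuv_monom p)"
    unfolding tuv_monom_def
    by (intro mps_homogeneous_mult mps_homogeneous_power mps_homogeneous_tuv_gens)
  then show ?thesis
    by (simp add: exp_degree_tuv algebra_simps)
qed

lemma mps_coeff_tuv_monom_eq_0:
  "exp_degree m \<noteq> 2 * exp_degree p \<Longrightarrow> mps_coeff (tuv_monom p) m = 0"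
  using mps_homogeneous_tuv_monom unfolding mps_homogeneous_def by metis

lemma tuv_embed_sums:
  "mps_sums (\<lambda>d. \<Sum>p | exp_degree p = d. mps_const (mps_coeff f p) * tuv_monom p) (tuv_embed f)"
  unfolding tuv_embed_def tuv_monom_def mult.assoc[symmetric]
proof (rule mps_sums_suminf)
  fix d
  show "mps_order_ge d (\<Sum>p | exp_degree p = d. mps_const (mps_coeff f p)
      * gen_t ^ (p $ Var_t) * gen_u ^ (p $ Var_u) * gen_v ^ (p $ Var_v))"
  proof (rule mps_order_ge_sum)
    fix p :: "nat ^ tuv" assume "p \<in> {p. exp_degree p = d}"
    then have "mps_order_ge d (mps_const (mps_coeff f p) * tuv_monom p)"
      by (simp add: mps_order_ge_def mps_coeff_tuv_monom_eq_0)
    then show "mps_order_ge d (mps_const (mps_coeff f p)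
        * gen_t ^ (p $ Var_t) * gen_u ^ (p $ Var_u) * gen_v ^ (p $ Var_v))"
      by (simp add: tuv_monom_def mult.assoc)
  qed
qed

text \<open>
  Since \<^term>\<open>tuv_monom p\<close> is homogeneous of degree \<^term>\<open>2 * exp_degree p\<close>, the monomials of
  degree above that of \<open>m\<close> do not contribute, so the infinite sum can be cut off at any such bound.
\<close>

lemma mps_coeff_tuv_embed:
  assumes "exp_degree m \<le> n"
  shows "mps_coeff (tuv_embed f) m =
    (\<Sum>p | exp_degree p \<le> n. mps_coeff f p * mps_coeff (tuv_monom p) m)"
proof -
  let ?c = "\<lambda>p. mps_coeff f p * mps_coeff (tuv_monom p) m"
  obtain N0 where N0: "\<And>N. N \<ge> N0 \<Longrightarrow>
      mps_coeff (\<Sum>d<N. \<Sum>p | exp_degree p = d. mps_const (mps_coeff f p) * tuv_monom p) m =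
      mps_coeff (tuv_embed f) m"
    using tuv_embed_sums[of f] unfolding mps_sums_def by blast
  define N where "N = max N0 (Suc n)"
  have N: "mps_coeff (\<Sum>d<N. \<Sum>p | exp_degree p = d. mps_const (mps_coeff f p) * tuv_monom p) m =
      mps_coeff (tuv_embed f) m" "n < N"
    using N0[of N] by (simp_all add: N_def)
  have "mps_coeff (tuv_embed f) m = (\<Sum>d<N. \<Sum>p | exp_degree p = d. ?c p)"
    by (simp flip: N(1))
  also have "\<dots> = sum ?c (\<Union>d<N. {p. exp_degree p = d})"
    by (rule sum.UNION_disjoint[symmetric]) auto
  also have "\<dots> = (\<Sum>p | exp_degree p \<le> n. ?c p)"
  proof (rule sum.mono_neutral_right)
    have "(\<Union>d<N. {p :: nat ^ tuv. exp_degree p = d}) \<subseteq> {p. exp_degree p \<le> N}"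
      by auto
    then show "finite (\<Union>d<N. {p :: nat ^ tuv. exp_degree p = d})"
      by (rule finite_subset) simp
  qed (use \<open>n < N\<close> assms in \<open>auto simp: mps_coeff_tuv_monom_eq_0\<close>)
  finally show ?thesis .
qed

lemma tuv_embed_add: "tuv_embed (f + g) = tuv_embed f + tuv_embed g"
  by (rule mps_eqI)
    (simp add: mps_coeff_tuv_embed[OF order_refl] distrib_right sum.distrib)

lemma tuv_embed_const: "tuv_embed (mps_const c) = mps_const c"
proof (rule mps_eqI)
  fix m
  have "mps_coeff (tuv_embed (mps_const c)) m =
      (\<Sum>p\<in>{0}. mps_coeff (mps_const c) p * mps_coeff (tuv_monom p) m)"
    unfolding mps_coeff_tuv_embed[OF order_refl]
    by (rule sum.mono_neutral_right) (auto simp: mps_coeff_const)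
  then show "mps_coeff (tuv_embed (mps_const c)) m = mps_coeff (mps_const c) m"
    by (simp add: mps_coeff_const mps_coeff_1)
qed

lemma tuv_embed_0 [simp]: "tuv_embed 0 = 0"
  and tuv_embed_1 [simp]: "tuv_embed 1 = 1"
  using tuv_embed_const[of 0] tuv_embed_const[of 1] by simp_all

lemma tuv_embed_monom: "tuv_embed (mps_monom q) = tuv_monom q"
proof (rule mps_eqI)
  fix m :: "nat ^ gen_var"
  define n where "n = max (exp_degree m) (exp_degree q)"
  have "mps_coeff (tuv_embed (mps_monom q)) m =
      (\<Sum>p | exp_degree p \<le> n. mps_coeff (mps_monom q) p * mps_coeff (tuv_monom p) m)"
    by (rule mps_coeff_tuv_embed) (simp add: n_def)
  also have "\<dots> = (\<Sum>p\<in>{q}. mps_coeff (mps_monom q) p * mps_coeff (tuv_monom p) m)"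
    by (rule sum.mono_neutral_right) (auto simp: mps_coeff_monom n_def)
  finally show "mps_coeff (tuv_embed (mps_monom q)) m = (mps_coeff (tuv_monom q) m :: 'a)"
    by (simp add: mps_coeff_monom)
qed

lemma tuv_embed_var:
  "tuv_embed (mps_var Var_t) = gen_t" "tuv_embed (mps_var Var_u) = gen_u"
  "tuv_embed (mps_var Var_v) = gen_v"
  by (simp_all add: mps_var_eq_monom tuv_embed_monom tuv_monom_def axis_def)

text \<open>
  In a fixed degree both factors may be replaced by polynomial truncations, which multiply like
  polynomials in the three traces; the pairs of exponents are then regrouped by their sum.
\<close>

lemma tuv_embed_mult: "tuv_embed (f * g) = tuv_embed f * tuv_embed g"
proof (rule mps_eqI)
  fix m :: "nat ^ gen_var"
  define n where "n = exp_degree m"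
  let ?B = "{p :: nat ^ tuv. exp_degree p \<le> n}"
  let ?E = "\<lambda>f. \<Sum>p\<in>?B. mps_const (mps_coeff f p) * tuv_monom p"
  let ?c = "\<lambda>(p, q). mps_coeff f p * mps_coeff g q * mps_coeff (tuv_monom (p + q)) m"
  have trunc: "mps_coeff (tuv_embed f) p = mps_coeff (?E f) p" if "exp_degree p \<le> n" for f p
    using mps_coeff_tuv_embed[OF that, of f] by simp
  have "mps_coeff (tuv_embed f * tuv_embed g) m = mps_coeff (?E f * ?E g) m"
    unfolding mps_coeff_mult
  proof (rule sum.cong[OF refl])
    fix z assume "z \<in> {(p, q). p + q = m}"
    then have "exp_degree (fst z) \<le> n" "exp_degree (snd z) \<le> n"
      by (auto simp: n_def)
    then show "(case z of (p, q) \<Rightarrow> mps_coeff (tuv_embed f) p * mps_coeff (tuv_embed g) q) =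
        (case z of (p, q) \<Rightarrow> mps_coeff (?E f) p * mps_coeff (?E g) q)"
      unfolding case_prod_beta by (simp only: trunc)
  qed
  also have "?E f * ?E g = (\<Sum>p\<in>?B. \<Sum>q\<in>?B. mps_const (mps_coeff f p * mps_coeff g q) * tuv_monom (p + q))"
    unfolding sum_product tuv_monom_add mps_const_mult[symmetric] by (simp add: mult_ac)
  also have "mps_coeff \<dots> m = (\<Sum>z\<in>?B \<times> ?B. ?c z)"
    by (simp add: sum.cartesian_product case_prod_beta)
  \<comment> \<open>Products of too high a degree have no coefficient at \<open>m\<close>.\<close>
  also have "\<dots> = (\<Sum>z\<in>{z. exp_degree (fst z + snd z) \<le> n}. ?c z)"
  proof (rule sum.mono_neutral_right)
    have "?c z = 0" if "\<not> exp_degree (fst z + snd z) \<le> n" for z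
      using that by (simp add: n_def case_prod_beta mps_coeff_tuv_monom_eq_0)
    then show "\<forall>z\<in>?B \<times> ?B - {z. exp_degree (fst z + snd z) \<le> n}. ?c z = 0"
      by blast
  qed auto
  also have "\<dots> = (\<Sum>y\<in>(SIGMA s:?B. {(p, q). p + q = s}). ?c (snd y))"
    by (rule sum.reindex_bij_witness[of _ snd "\<lambda>z. (fst z + snd z, z)"]) auto
  also have "\<dots> = (\<Sum>s\<in>?B. \<Sum>z\<in>{(p, q). p + q = s}. ?c z)"
    by (subst sum.Sigma) (auto simp: finite_exponents_sum case_prod_beta)
  also have "\<dots> = (\<Sum>s\<in>?B. mps_coeff (f * g) s * mps_coeff (tuv_monom s) m)"
    unfolding mps_coeff_mult sum_distrib_right by (intro sum.cong) auto
  also have "\<dots> = mps_coeff (tuv_embed (f * g)) m"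
    by (rule mps_coeff_tuv_embed[symmetric]) (simp add: n_def)
  finally show "mps_coeff (tuv_embed (f * g)) m = mps_coeff (tuv_embed f * tuv_embed g) m" ..
qed

lemma tuv_embed_uminus: "tuv_embed (- f) = - tuv_embed f"
  using tuv_embed_add[of "- f" f] by (simp add: eq_neg_iff_add_eq_0)

lemma tuv_embed_diff: "tuv_embed (f - g) = tuv_embed f - tuv_embed g"
  using tuv_embed_add[of f "- g"] by (simp add: tuv_embed_uminus)

lemma tuv_embed_numeral_2: "tuv_embed 2 = 2"
  using tuv_embed_add[of 1 1] by simp

lemma tuv_embed_sum: "tuv_embed (sum f A) = (\<Sum>a\<in>A. tuv_embed (f a))"
  by (induction A rule: infinite_finite_induct) (auto simp: tuv_embed_add)

lemma mps_sums_tuv_embed: "mps_sums f s \<Longrightarrow> mps_sums (\<lambda>n. tuv_embed (f n)) (tuv_embed s)"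
proof (erule mps_sums_continuous)
  fix m :: "nat ^ gen_var"
  show "\<exists>P. finite P \<and> (\<forall>h h'. (\<forall>p\<in>P. mps_coeff h p = mps_coeff h' p) \<longrightarrow>
      mps_coeff (tuv_embed h) m = mps_coeff (tuv_embed h') m)"
    by (rule exI[of _ "{p. exp_degree p \<le> exp_degree m}"])
      (simp add: mps_coeff_tuv_embed[OF order_refl])
qed (rule tuv_embed_sum)

lemma hom_component_tuv_embed:
  "mps_hom_component d (tuv_embed f) = (if even d then tuv_embed (mps_hom_component (d div 2) f) else 0)"
  for f :: "'k::comm_ring_1 tuv_series"
proof (rule mps_eqI)
  fix m
  let ?c = "\<lambda>p. mps_coeff (tuv_monom p) m :: 'k"
  have eq: "(if exp_degree m = d then mps_coeff f p * ?c p else 0) =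
      (if even d then (if exp_degree p = d div 2 then mps_coeff f p else 0) * ?c p else 0)" for p
  proof (cases "exp_degree m = 2 * exp_degree p")
    case False
    then have "?c p = 0" by (rule mps_coeff_tuv_monom_eq_0)
    then show ?thesis by simp
  next
    case True
    then have "exp_degree m = d \<longleftrightarrow> even d \<and> exp_degree p = d div 2"
      by presburger
    then show ?thesis by (cases "exp_degree m = d") (simp_all split: if_split)
  qed
  have "mps_coeff (mps_hom_component d (tuv_embed f)) m =
      (\<Sum>p | exp_degree p \<le> exp_degree m. if exp_degree m = d then mps_coeff f p * ?c p else 0)"
    by (simp add: mps_coeff_hom_component mps_coeff_tuv_embed[OF order_refl])
  also have "\<dots> = mps_coeff (if even d then tuv_embed (mps_hom_component (d div 2) f) else 0) m"
    unfolding eq by (simp add: mps_coeff_hom_component mps_coeff_tuv_embed[OF order_refl])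
  finally show "mps_coeff (mps_hom_component d (tuv_embed f)) m =
      mps_coeff (if even d then tuv_embed (mps_hom_component (d div 2) f) else 0) m" .
qed

section \<open>Setting variables to zero\<close>

text \<open>
  Deleting every monomial that involves a variable in \<open>V\<close> is the substitution of 0 for the
  variables in \<open>V\<close>, hence a ring homomorphism.
\<close>

definition mps_restrict :: "'v set \<Rightarrow> ('v::finite, 'k::comm_ring_1) mps \<Rightarrow> ('v, 'k) mps" where
  "mps_restrict V f = Abs_mps (\<lambda>m. if \<forall>i\<in>V. m $ i = 0 then mps_coeff f m else 0)"

lemma mps_coeff_restrict:
  "mps_coeff (mps_restrict V f) m = (if \<forall>i\<in>V. m $ i = 0 then mps_coeff f m else 0)"
  by (simp add: mps_restrict_def)

lemma mps_restrict_add: "mps_restrict V (f + g) = mps_restrict V f + mps_restrict V g"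
  by (rule mps_eqI) (simp add: mps_coeff_restrict)

lemma mps_restrict_0 [simp]: "mps_restrict V 0 = 0"
  by (rule mps_eqI) (simp add: mps_coeff_restrict)

lemma mps_restrict_1 [simp]: "mps_restrict V 1 = 1"
  by (rule mps_eqI) (auto simp: mps_coeff_restrict mps_coeff_1)

lemma mps_restrict_mult: "mps_restrict V (f * g) = mps_restrict V f * mps_restrict V g"
proof (rule mps_eqI)
  fix m
  show "mps_coeff (mps_restrict V (f * g)) m = mps_coeff (mps_restrict V f * mps_restrict V g) m"
  proof (cases "\<forall>i\<in>V. m $ i = 0")
    case True
    then show ?thesis
      by (auto simp: mps_coeff_restrict mps_coeff_mult intro!: sum.cong)
  next
    case False
    have "(\<Sum>(p, q)\<in>{(p, q). p + q = m}. mps_coeff (mps_restrict V f) p * mps_coeff (mps_restrict V g) q) = 0"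
      using False by (intro sum.neutral) (auto simp: mps_coeff_restrict)
    moreover have "mps_coeff (mps_restrict V (f * g)) m = 0"
      using False by (auto simp: mps_coeff_restrict)
    ultimately show ?thesis
      by (simp only: mps_coeff_mult)
  qed
qed

lemma mps_restrict_power: "mps_restrict V (f ^ n) = mps_restrict V f ^ n"
  by (induction n) (auto simp: mps_restrict_mult)

lemma mps_restrict_var: "mps_restrict V (mps_var i) = (if i \<in> V then 0 else mps_var i)"
  by (rule mps_eqI) (auto simp: mps_coeff_restrict mps_coeff_var axis_def)


section \<open>Linear independence of $x$, $y$, $[x,y]$ over $K[[t,u,v]]$\<close>

lemma mat_mult_nth [simp]: "(mat a ** Z) $ i $ j = a * Z $ i $ j"
  for a :: "'a::comm_ring_1" and Z :: "'a ^ 'm ^ 'n"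
  by (simp add: matrix_matrix_mult_def mat_def if_distrib[of "\<lambda>y. y * _"] cong: if_cong)

lemma mat_vector_mult: "mat a *v w = a *s w"
  for a :: "'a::comm_ring_1" and w :: "'a ^ 'n"
  by (simp add: vec_eq_iff matrix_vector_mult_def mat_def if_distrib[of "\<lambda>y. y * _"] cong: if_cong)

lemma lin_comb_nth:
  "lin_comb a b c $ i $ j = tuv_embed a * gen_x $ i $ j + tuv_embed b * gen_y $ i $ j
    + tuv_embed c * commutator gen_x gen_y $ i $ j"
  by (simp add: lin_comb_def)

lemma commutator_gen_nth:
  "commutator gen_x gen_y $ 1 $ 1 = mps_var X12 * mps_var Y21 - mps_var X21 * mps_var Y12"
  "commutator gen_x gen_y $ 1 $ 2 = 2 * (mps_var X11 * mps_var Y12 - mps_var X12 * mps_var Y11)"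
  "commutator gen_x gen_y $ 2 $ 1 = 2 * (mps_var X21 * mps_var Y11 - mps_var X11 * mps_var Y21)"
  "commutator gen_x gen_y $ 2 $ 2 = mps_var X21 * mps_var Y12 - mps_var X12 * mps_var Y21"
  by (simp_all add: commutator_def gen_x_def gen_y_def matrix_matrix_mult_def sum_2 algebra_simps)

lemma gen_nth:
  "gen_x $ 1 $ 1 = mps_var X11" "gen_x $ 1 $ 2 = mps_var X12"
  "gen_x $ 2 $ 1 = mps_var X21" "gen_x $ 2 $ 2 = - mps_var X11"
  "gen_y $ 1 $ 1 = mps_var Y11" "gen_y $ 1 $ 2 = mps_var Y12"
  "gen_y $ 2 $ 1 = mps_var Y21" "gen_y $ 2 $ 2 = - mps_var Y11"
  by (simp_all add: gen_x_def gen_y_def)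

text \<open>
  At $x_{11} = y_{12} = 0$ the traces become the monomials $t = 2 x_{12} x_{21}$,
  $u = 2 y_{11}^2$ and $v = x_{12} y_{21}$, with linearly independent exponents. This is the exponent
  of the specialization of the monomial in $t,u,v$ with exponent \<open>p\<close>.
\<close>

definition special_exponent :: "nat ^ tuv \<Rightarrow> nat ^ gen_var" where
  "special_exponent p = axis X12 (p $ Var_t + p $ Var_v) + axis X21 (p $ Var_t)
     + axis Y11 (2 * p $ Var_u) + axis Y21 (p $ Var_v)"

lemma special_exponent_nth [simp]:
  "special_exponent p $ X11 = 0" "special_exponent p $ X12 = p $ Var_t + p $ Var_v" "special_exponent p $ X21 = p $ Var_t"
  "special_exponent p $ Y11 = 2 * p $ Var_u" "special_exponent p $ Y12 = 0" "special_exponent p $ Y21 = p $ Var_v"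
  by (simp_all add: special_exponent_def axis_def)

lemma special_exponent_inject: "special_exponent p = special_exponent q \<longleftrightarrow> p = q"
proof
  assume "special_exponent p = special_exponent q"
  then have "special_exponent p $ i = special_exponent q $ i" for i
    by simp
  from this[of X21] this[of Y11] this[of Y21] have "p $ i = q $ i" for i
    by (cases i) auto
  then show "p = q"
    by (simp add: vec_eq_iff)
qed simp

lemma mps_var_power: "mps_var i ^ n = mps_monom (axis i n)"
proof (induction n)
  case 0
  have "axis i 0 = (0 :: nat ^ 'a)"
    by (simp add: vec_eq_iff axis_def)
  then show ?case
    by (auto intro!: mps_eqI simp: mps_coeff_monom mps_coeff_1)
next
  case (Suc n)
  have "axis i 1 + axis i n = (axis i (Suc n) :: nat ^ 'a)"
    by (simp add: vec_eq_iff axis_def)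
  then show ?case
    unfolding power_Suc Suc by (simp only: mps_var_eq_monom mps_monom_mult)
qed

abbreviation gen_specialize :: "(gen_var, 'k::comm_ring_1) mps \<Rightarrow> (gen_var, 'k) mps" where
  "gen_specialize \<equiv> mps_restrict {X11, Y12}"

lemma gen_specialize_tuv_monom:
  "gen_specialize (tuv_monom p) = mps_const (2 ^ (p $ Var_t + p $ Var_u)) * mps_monom (special_exponent p)"
  (is "_ = mps_const (2 ^ (?i + ?j)) * _")
proof -
  have two: "(2 :: (gen_var, 'a) mps) = mps_const 2"
    using mps_const_add[of "1 :: 'a" 1] by simp
  have twop: "mps_const 2 ^ n = (mps_const (2 ^ n) :: (gen_var, 'a) mps)" for n
    by (induction n) (simp_all add: mps_const_mult)
  have r: "gen_specialize (2 :: (gen_var, 'a) mps) = 2"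
    using mps_restrict_add[of "{X11, Y12}" "1 :: (gen_var, 'a) mps" 1] by simp
  have "gen_specialize (tuv_monom p) = (2 * (mps_var X12 * mps_var X21)) ^ ?i
      * (2 * mps_var Y11 ^ 2) ^ ?j * (mps_var X12 * mps_var Y21 :: (gen_var, 'a) mps) ^ (p $ Var_v)"
    unfolding tuv_monom_def gen_t_eq gen_u_eq gen_v_eq
    by (simp add: mps_restrict_mult mps_restrict_power mps_restrict_add mps_restrict_var r
        power2_eq_square)
  also have "\<dots> = 2 ^ (?i + ?j) * (mps_var X12 ^ (?i + p $ Var_v) * mps_var X21 ^ ?i
      * mps_var Y11 ^ (2 * ?j) * mps_var Y21 ^ (p $ Var_v))"
    by (simp add: power_mult_distrib power_add power_mult power2_eq_square mult_ac)
  also have "\<dots> = mps_const (2 ^ (?i + ?j)) * mps_monom (special_exponent p)"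
    by (simp add: two twop mps_var_power mps_monom_mult special_exponent_def)
  finally show ?thesis .
qed

lemma mps_coeff_tuv_monom_restrict:
  assumes "m $ X11 = 0" "m $ Y12 = 0"
  shows "mps_coeff (tuv_monom p :: (gen_var, 'k::comm_ring_1) mps) m =
    (if m = special_exponent p then 2 ^ (p $ Var_t + p $ Var_u) else 0)"
proof -
  have "mps_coeff (tuv_monom p) m = mps_coeff (gen_specialize (tuv_monom p) :: (gen_var, 'k) mps) m"
    using assms by (simp add: mps_coeff_restrict)
  then show ?thesis
    by (simp add: gen_specialize_tuv_monom mps_coeff_monom)
qed

text \<open>
  Distinct monomials in $t,u,v$ specialize to multiples of distinct monomials, so each coefficient
  of a series in $t,u,v$ can be read off its image. In characteristic 0 this gives the algebraic
  independence of the three traces.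
\<close>

lemma mps_coeff_tuv_embed_special:
  "mps_coeff (tuv_embed f) (special_exponent q) = 2 ^ (q $ Var_t + q $ Var_u) * mps_coeff f q"
proof -
  define n where "n = max (exp_degree (special_exponent q)) (exp_degree q)"
  have "mps_coeff (tuv_embed f) (special_exponent q) =
      (\<Sum>p | exp_degree p \<le> n. mps_coeff f p * mps_coeff (tuv_monom p) (special_exponent q))"
    by (rule mps_coeff_tuv_embed) (simp add: n_def)
  also have "\<dots> = (\<Sum>p\<in>{q}. mps_coeff f p * mps_coeff (tuv_monom p) (special_exponent q))"
    by (rule sum.mono_neutral_right)
      (auto simp: n_def mps_coeff_tuv_monom_restrict special_exponent_inject)
  finally show ?thesis
    by (simp add: mps_coeff_tuv_monom_restrict)
qed

text \<open>
  After the specialization $y_{11}$ occurs only through $u = 2 y_{11}^2$, so only in even powers.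
\<close>

lemma mps_coeff_tuv_embed_odd:
  assumes "m $ X11 = 0" "m $ Y12 = 0" "odd (m $ Y11)"
  shows "mps_coeff (tuv_embed f) m = 0"
proof -
  have "m \<noteq> special_exponent p" for p
    using assms(3) by (metis special_exponent_nth(4) dvd_triv_left)
  then show ?thesis
    using assms by (simp add: mps_coeff_tuv_embed[OF order_refl] mps_coeff_tuv_monom_restrict)
qed

lemma mps_coeff_Y11_mult_tuv_embed:
  assumes "m $ X11 = 0" "m $ Y12 = 0" "even (m $ Y11)"
  shows "mps_coeff (mps_monom (axis Y11 1) * gen_specialize (tuv_embed f)) m = 0"
proof (cases "\<exists>q. m = axis Y11 1 + q")
  case True
  then obtain q where m: "m = axis Y11 1 + q" by blast
  have "q $ X11 = 0" "q $ Y12 = 0" "odd (q $ Y11)"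
    using assms by (auto simp: m axis_def)
  then show ?thesis
    by (simp add: m mps_coeff_monom_mult_add mps_coeff_restrict mps_coeff_tuv_embed_odd)
next
  case False
  then show ?thesis
    by (intro mps_coeff_monom_mult_eq_0) blast
qed

text \<open>
  At $x_{11} = y_{12} = 0$ the $(1,2)$ entry of the combination is $x_{12} (a - 2 c y_{11})$. There
  $a$ and $c$ contain $y_{11}$ only in even powers, so if the entry vanishes, its part of even degree
  in $y_{11}$ gives $a = 0$ and the part of odd degree gives $c = 0$. What then remains of the $(1,1)$
  entry is $b y_{11}$.
\<close>

lemma lin_comb_eq_0D:
  fixes a b c :: "'k::field_char_0 tuv_series"
  assumes "lin_comb a b c = 0"
  shows "a = 0 \<and> b = 0 \<and> c = 0"
proof -
  let ?R = gen_specialize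
  let ?E = "\<lambda>f. gen_specialize (tuv_embed f) :: (gen_var, 'k) mps"
  let ?x12 = "mps_monom (axis X12 1) :: (gen_var, 'k) mps"
  let ?y11 = "mps_monom (axis Y11 1) :: (gen_var, 'k) mps"
  have r2: "?R 2 = (2 :: (gen_var, 'k) mps)"
    using mps_restrict_add[of "{X11, Y12}" "1 :: (gen_var, 'k) mps" 1] by simp
  have rminus: "?R (- f) = - ?R f" for f :: "(gen_var, 'k) mps"
    by (rule mps_eqI) (simp add: mps_coeff_restrict)
  have rdiff: "?R (f - g) = ?R f - ?R g" for f g :: "(gen_var, 'k) mps"
    by (rule mps_eqI) (simp add: mps_coeff_restrict)
  note R = mps_restrict_add mps_restrict_mult rdiff rminus r2 mps_restrict_var
  have shape: "mps_coeff (?E f) (special_exponent q) = 0 \<longleftrightarrow> mps_coeff f q = 0" for f q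
    by (simp add: mps_coeff_restrict mps_coeff_tuv_embed_special)
  have "?R (lin_comb a b c $ 1 $ 2) = 0"
    by (simp add: assms)
  then have "?E a * mps_var X12 - ?E c * (2 * (mps_var X12 * mps_var Y11)) = 0"
    by (simp add: lin_comb_nth gen_nth commutator_gen_nth R)
  then have "?x12 * (?E a - (?y11 * ?E c + ?y11 * ?E c)) = 0"
    by (simp add: mps_var_eq_monom algebra_simps)
  then have coeff12: "mps_coeff (?E a) q = mps_coeff (?y11 * ?E c) q + mps_coeff (?y11 * ?E c) q" for q
    using mps_coeff_monom_mult_add[of "axis X12 1" "?E a - (?y11 * ?E c + ?y11 * ?E c)" q]
    by (simp only: mps_coeff_0 mps_coeff_diff mps_coeff_add eq_commute[of 0] right_minus_eq)
  \<comment> \<open>The exponent has even $y_{11}$ part, so the right-hand side of \<open>coeff12\<close> vanishes.\<close>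
  have "mps_coeff a q = 0" for q
    using coeff12[of "special_exponent q"] mps_coeff_Y11_mult_tuv_embed[of "special_exponent q" c]
    by (intro shape[THEN iffD1]) simp
  then have a: "a = 0"
    by (intro mps_eqI) simp
  \<comment> \<open>One more factor $y_{11}$ makes the exponent odd and selects the coefficients of \<open>c\<close>.\<close>
  have "mps_coeff c q = 0" for q
    using coeff12[of "axis Y11 1 + special_exponent q"]
    by (intro shape[THEN iffD1]) (simp add: a mps_coeff_monom_mult_add)
  then have c: "c = 0"
    by (intro mps_eqI) simp
  have "?R (lin_comb a b c $ 1 $ 1) = 0"
    by (simp add: assms)
  then have "?E b * mps_var Y11 = 0"
    by (simp add: lin_comb_nth gen_nth R a c)
  then have "?y11 * ?E b = 0"
    by (simp add: mps_var_eq_monom mult.commute)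
  then have "mps_coeff b q = 0" for q
    using mps_coeff_monom_mult_add[of "axis Y11 1" "?E b" "special_exponent q"] by (intro shape[THEN iffD1]) simp
  then have "b = 0"
    by (intro mps_eqI) simp
  with a c show ?thesis by simp
qed

lemma lin_comb_diff:
  "lin_comb a b c - lin_comb a' b' c' = lin_comb (a - a') (b - b') (c - c')"
  by (simp add: vec_eq_iff lin_comb_nth tuv_embed_diff algebra_simps)

lemma lin_comb_inject:
  fixes a b c :: "'k::field_char_0 tuv_series"
  shows "lin_comb a b c = lin_comb a' b' c' \<longleftrightarrow> a = a' \<and> b = b' \<and> c = c'"
  using lin_comb_eq_0D[of "a - a'" "b - b'" "c - c'"] by (auto simp flip: lin_comb_diff)

section \<open>The degree filtration in coordinates\<close>

lemma mps_homogeneous_gen_nth: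
  "mps_homogeneous 1 (gen_x $ i $ j :: (gen_var, 'k::comm_ring_1) mps)" (is ?x)
  "mps_homogeneous 1 (gen_y $ i $ j :: (gen_var, 'k) mps)" (is ?y)
proof -
  show ?x ?y
    using exhaust_2[of i] exhaust_2[of j]
    by (auto simp: gen_nth mps_homogeneous_var[simplified] mps_homogeneous_uminus)
qed

lemma mps_homogeneous_commutator_nth:
  "mps_homogeneous 2 (commutator gen_x gen_y $ i $ j :: (gen_var, 'k::comm_ring_1) mps)"
proof -
  have mult: "mps_homogeneous 2 (f * g)" if "mps_homogeneous 1 f" "mps_homogeneous 1 g"
    for f g :: "(gen_var, 'k) mps"
    using mps_homogeneous_mult[OF that] by (simp add: numeral_2_eq_2)
  have "mps_homogeneous 2 ((gen_x ** gen_y) $ i $ j :: (gen_var, 'k) mps)"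
    "mps_homogeneous 2 ((gen_y ** gen_x) $ i $ j :: (gen_var, 'k) mps)"
    unfolding matrix_matrix_mult_def vec_lambda_beta sum_2
    by (intro mps_homogeneous_add mult mps_homogeneous_gen_nth)+
  from mps_homogeneous_add[OF this(1) mps_homogeneous_uminus[OF this(2)]] show ?thesis
    by (simp add: commutator_def)
qed

text \<open>
  Series in $t,u,v$ live in even degrees, $x$ and $y$ in degree 1 and $[x,y]$ in degree 2. Hence odd
  components involve only the coordinates at $x$ and $y$, and even ones only that at $[x,y]$. As
  subtraction of natural numbers is truncated, degree 0 is a separate case.
\<close>

lemma hom_component_lin_comb:
  "hom_component d (lin_comb a b c) =
    (if odd d then lin_comb (mps_hom_component (d div 2) a) (mps_hom_component (d div 2) b) 0
     else if d = 0 then 0 else lin_comb 0 0 (mps_hom_component (d div 2 - 1) c))"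
proof -
  note hom = mps_hom_component_mult_homogeneous[OF mps_homogeneous_gen_nth(1)]
    mps_hom_component_mult_homogeneous[OF mps_homogeneous_gen_nth(2)]
    mps_hom_component_mult_homogeneous[OF mps_homogeneous_commutator_nth]
  consider k where "d = 2 * k + 1" | "d = 0" | k where "d = 2 * Suc k"
    by (metis evenE oddE not0_implies_Suc mult_0_right)
  then show ?thesis
    by cases (simp_all add: vec_eq_iff hom_component_def lin_comb_nth mps_hom_component_add hom
        hom_component_tuv_embed)
qed

lemma alg_W_scalar_sum:
  "(\<And>a. a \<in> A \<Longrightarrow> mat (f a) \<in> alg_W) \<Longrightarrow> mat (sum f A) \<in> alg_W"
  for f :: "'a \<Rightarrow> (gen_var, 'k::comm_ring_1) mps"
proof (induction A rule: infinite_finite_induct)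
  case (insert x A)
  have "mat (f x + sum f A) = mat (f x) + (mat (sum f A) :: 'k gen_matrix)"
    by (simp add: vec_eq_iff mat_def)
  then show ?case
    using insert by (simp add: alg_W.add)
qed (use alg_W.const[of 0] in simp_all)

lemma alg_W_scalar_mult:
  assumes "mat f \<in> alg_W" "mat g \<in> alg_W"
  shows "mat (f * g) \<in> alg_W"
proof -
  have "mat (f * g) = mat f ** (mat g :: 'a gen_matrix)"
    by (simp add: vec_eq_iff) (simp add: mat_def)
  then show ?thesis
    using assms by (simp add: alg_W.mult)
qed

lemma alg_W_scalar_power: "mat f \<in> alg_W \<Longrightarrow> mat (f ^ n) \<in> alg_W"
  using alg_W.const[of 1] by (induction n) (auto intro: alg_W_scalar_mult)

text \<open>
  By the Cayley--Hamilton theorem the square of a traceless matrix is scalar; these are that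
  fact and its polarization. They show that the traces belong to the algebra generated by $x,y$.
\<close>

lemma mat_tuv_gens:
  "mat gen_t = gen_x ** gen_x + gen_x ** gen_x"
  "mat gen_u = gen_y ** gen_y + gen_y ** gen_y"
  "mat gen_v = gen_x ** gen_y + gen_y ** gen_x"
  unfolding gen_t_eq gen_u_eq gen_v_eq
  by (simp_all add: vec_eq_iff forall_2 mat_def matrix_matrix_mult_def sum_2 gen_nth algebra_simps)

lemma tuv_monom_in_alg_W: "mat (tuv_monom p) \<in> alg_W"
proof -
  have "mat gen_t \<in> alg_W" "mat gen_u \<in> alg_W" "mat gen_v \<in> alg_W"
    unfolding mat_tuv_gens by (intro alg_W.intros)+
  then show ?thesis
    unfolding tuv_monom_def by (intro alg_W_scalar_mult alg_W_scalar_power)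
qed

lemma mps_hom_component_eq_sum:
  "mps_hom_component d f = (\<Sum>p | exp_degree p = d. mps_const (mps_coeff f p) * mps_monom p)"
  by (rule mps_eqI)
    (simp add: mps_coeff_hom_component mps_coeff_monom if_distrib[of "\<lambda>y. _ * y"] sum.delta cong: if_cong)

lemma tuv_embed_hom_component_in_alg_W: "mat (tuv_embed (mps_hom_component d f)) \<in> alg_W"
  unfolding mps_hom_component_eq_sum tuv_embed_sum tuv_embed_mult tuv_embed_const tuv_embed_monom
  by (intro alg_W_scalar_sum alg_W_scalar_mult alg_W.const tuv_monom_in_alg_W)

lemma commutator_gen_in_alg_W: "commutator gen_x gen_y \<in> alg_W"
proof -
  have "commutator gen_x gen_y = gen_x ** gen_y + mat (mps_const (- 1)) ** (gen_y ** gen_x)"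
    by (simp add: vec_eq_iff commutator_def mps_const_uminus_1)
  then show ?thesis
    by (metis alg_W.intros)
qed

lemma lin_comb_in_W_hat: "lin_comb a b c \<in> W_hat"
proof -
  have zero: "(0 :: 'a gen_matrix) \<in> alg_W"
    using alg_W.const[of 0] by simp
  have "mat (tuv_embed (0 :: 'a tuv_series)) \<in> alg_W"
    using zero by simp
  then have "hom_component d (lin_comb a b c) \<in> alg_W" for d
    unfolding hom_component_lin_comb using zero
    by (auto simp: lin_comb_def intro!: alg_W.intros commutator_gen_in_alg_W tuv_embed_hom_component_in_alg_W)
  then show ?thesis
    by (simp add: W_hat_def)
qed

text \<open>
  By linear independence a homogeneous component vanishes exactly when the components of the
  coordinates that it is made of do. A coordinate of degree $k$ contributes in degree $2k+1$ at
  $x$ and $y$, but in degree $2k+2$ at $[x,y]$; this is the reason for the weaker bound on \<open>c\<close>.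
\<close>

lemma lin_comb_in_omega_W_hat_iff:
  fixes a b c :: "'k::field_char_0 tuv_series"
  shows "lin_comb a b c \<in> omega_W_hat (r + 1) \<longleftrightarrow>
    mps_order_ge ((r + 1) div 2) a \<and> mps_order_ge ((r + 1) div 2) b \<and> mps_order_ge (r div 2) c"
proof -
  have comp0: "mps_hom_component k f = 0 \<longleftrightarrow> (\<forall>m. exp_degree m = k \<longrightarrow> mps_coeff f m = 0)"
    for k and f :: "'k tuv_series"
    by (metis mps_coeff_0 mps_coeff_hom_component mps_eqI)
  have order: "mps_order_ge n f \<longleftrightarrow> (\<forall>k<n. mps_hom_component k f = 0)" for n and f :: "'k tuv_series"
    by (auto simp: mps_order_ge_def comp0)
  have lin0: "lin_comb a b c = 0 \<longleftrightarrow> a = 0 \<and> b = 0 \<and> c = 0" for a b c :: "'k tuv_series"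
    using lin_comb_inject[of a b c 0 0 0] by (simp add: vec_eq_iff lin_comb_nth)
  have "lin_comb a b c \<in> omega_W_hat (r + 1) \<longleftrightarrow>
      (\<forall>d<r + 1. hom_component d (lin_comb a b c) = 0)"
    by (simp add: omega_W_hat_def lin_comb_in_W_hat)
  also have "\<dots> \<longleftrightarrow> (\<forall>k<(r + 1) div 2. mps_hom_component k a = 0 \<and> mps_hom_component k b = 0) \<and>
      (\<forall>k<r div 2. mps_hom_component k c = 0)" (is "?L \<longleftrightarrow> ?R")
  proof
    assume L: ?L
    show ?R
    proof (intro conjI allI impI)
      fix k
      {
        assume "k < (r + 1) div 2"
        then have "2 * k + 1 < r + 1" by auto
        with L have "hom_component (2 * k + 1) (lin_comb a b c) = 0" by blast
        then show "mps_hom_component k a = 0" "mps_hom_component k b = 0"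
          by (simp_all add: hom_component_lin_comb lin0)
      }
      assume "k < r div 2"
      then have "2 * k + 2 < r + 1" by auto
      with L have "hom_component (2 * k + 2) (lin_comb a b c) = 0" by blast
      then show "mps_hom_component k c = 0"
        by (simp add: hom_component_lin_comb lin0)
    qed
  next
    assume R: ?R
    show ?L
    proof (intro allI impI)
      fix d assume d: "d < r + 1"
      consider k where "d = 2 * k + 1" | "d = 0" | k where "d = 2 * Suc k"
        by (metis evenE oddE not0_implies_Suc mult_0_right)
      then show "hom_component d (lin_comb a b c) = 0"
      proof cases
        case 1
        then have "k < (r + 1) div 2" using d by auto
        with R 1 show ?thesis by (simp add: hom_component_lin_comb lin0)
      next
        case 3
        then have "k < r div 2" using d by auto
        with R 3 show ?thesis by (simp add: hom_component_lin_comb lin0)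
      qed (simp add: hom_component_lin_comb)
    qed
  qed
  also have "\<dots> \<longleftrightarrow> mps_order_ge ((r + 1) div 2) a \<and> mps_order_ge ((r + 1) div 2) b
      \<and> mps_order_ge (r div 2) c"
    by (auto simp: order)
  finally show ?thesis .
qed

section \<open>The inner derivation and its exponential in coordinates\<close>

text \<open>
  Coordinate vectors refer to $x$, $y$, $[x,y]$ in this order, so that an endomorphism with
  associated matrix \<open>S\<close> acts as multiplication by \<open>S\<close> from the left.
\<close>

abbreviation of_coords :: "'k::comm_ring_1 tuv_series ^ 3 \<Rightarrow> 'k gen_matrix" where
  "of_coords w \<equiv> lin_comb (w $ 1) (w $ 2) (w $ 3)"

lemma of_coords_axis:
  "of_coords (axis 1 1) = gen_x" "of_coords (axis 2 1) = gen_y"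
  "of_coords (axis 3 1) = commutator gen_x gen_y"
  by (simp_all add: vec_eq_iff lin_comb_nth axis_def)

lemma commutator_add:
  "commutator (y + z) w = commutator y w + commutator z w"
  "commutator w (y + z) = commutator w y + commutator w z"
  by (simp_all add: vec_eq_iff commutator_def matrix_matrix_mult_def sum_2 algebra_simps)

lemma commutator_scalar:
  "commutator (mat a ** z) w = mat a ** commutator z w"
  "commutator w (mat a ** z) = mat a ** commutator w z"
  by (simp_all add: vec_eq_iff commutator_def matrix_matrix_mult_def[of _ "_ :: 'a gen_matrix"]
      sum_2 mat_def forall_2 algebra_simps)

lemma commutator_anti: "commutator z w = - commutator w z"
  by (simp add: commutator_def)

lemma commutator_nth:
  "commutator z w $ i $ j = z $ i $ 1 * w $ 1 $ j + z $ i $ 2 * w $ 2 $ j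
    - (w $ i $ 1 * z $ 1 $ j + w $ i $ 2 * z $ 2 $ j)"
  by (simp add: commutator_def matrix_matrix_mult_def sum_2)

text \<open>
  These two relations and bilinearity determine all commutators of elements in the span of
  $x$, $y$, $[x,y]$ over the centre.
\<close>

lemma commutator_gen_commutator:
  "commutator gen_x (commutator gen_x gen_y) = lin_comb (- 2 * mps_var Var_v) (2 * mps_var Var_t) 0"
  "commutator gen_y (commutator gen_x gen_y) = lin_comb (- 2 * mps_var Var_u) (2 * mps_var Var_v) 0"
  by (simp_all add: vec_eq_iff forall_2 lin_comb_nth tuv_embed_mult tuv_embed_uminus tuv_embed_numeral_2
      tuv_embed_var gen_t_eq gen_u_eq gen_v_eq gen_nth commutator_gen_nth
      commutator_nth[of _ "commutator _ _"] algebra_simps)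

definition ad_matrix ::
  "'k::comm_ring_1 tuv_series \<Rightarrow> 'k tuv_series \<Rightarrow> 'k tuv_series \<Rightarrow> 'k tuv_series ^ 3 ^ 3" where
  "ad_matrix a b c = (let t = mps_var Var_t; u = mps_var Var_u; v = mps_var Var_v in
     vector [vector [- 2 * c * v, - 2 * c * u, 2 * (a * v + b * u)],
             vector [2 * c * t, 2 * c * v, - 2 * (a * t + b * v)],
             vector [b, - a, 0]])"

text \<open>
  The characteristic polynomial of \<^term>\<open>ad_matrix a b c\<close> is $\lambda^3 - g \lambda$, where $g$ is
  this series, so the non-zero eigenvalues of the derivation are $\pm\sqrt g$.
\<close>

definition ad_eigval_sq ::
  "'k::comm_ring_1 tuv_series \<Rightarrow> 'k tuv_series \<Rightarrow> 'k tuv_series \<Rightarrow> 'k tuv_series" where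
  "ad_eigval_sq a b c = (let t = mps_var Var_t; u = mps_var Var_u; v = mps_var Var_v in
     2 * (a^2 * t + 2 * a * b * v + b^2 * u + 2 * c^2 * (v^2 - t * u)))"

lemma ad_of_coords: "ad (lin_comb a b c) (of_coords w) = of_coords (ad_matrix a b c *v w)"
proof -
  have self: "commutator z z = 0" for z :: "'a gen_matrix"
    by (simp add: commutator_def)
  have swap: "commutator gen_y gen_x = - commutator gen_x (gen_y :: 'a gen_matrix)"
    "commutator (commutator gen_x gen_y) gen_x = - commutator gen_x (commutator gen_x (gen_y :: 'a gen_matrix))"
    "commutator (commutator gen_x gen_y) gen_y = - commutator gen_y (commutator gen_x (gen_y :: 'a gen_matrix))"
    by (rule commutator_anti)+
  have "ad (lin_comb a b c) (of_coords w) $ i $ j = of_coords (ad_matrix a b c *v w) $ i $ j" for i j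
    unfolding ad_def lin_comb_def[of a b c] lin_comb_def[of "w $ 1" "w $ 2" "w $ 3"]
      commutator_add commutator_scalar self swap commutator_gen_commutator
    by (simp add: lin_comb_nth ad_matrix_def matrix_vector_mult_def sum_3 tuv_embed_mult
        tuv_embed_add tuv_embed_diff tuv_embed_uminus tuv_embed_numeral_2 Let_def)
      (simp add: algebra_simps)
  then show ?thesis
    by (simp add: vec_eq_iff)
qed

text \<open>
  This is the Cayley--Hamilton relation $M^3 = g M$, applied to a vector.
\<close>

lemma ad_matrix_cubed:
  "ad_matrix a b c *v (ad_matrix a b c *v (ad_matrix a b c *v w)) =
    ad_eigval_sq a b c *s (ad_matrix a b c *v w)"
  by (simp add: vec_eq_iff forall_3 ad_matrix_def ad_eigval_sq_def Let_def matrix_vector_mult_def sum_3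
      power2_eq_square algebra_simps)

lemma ad_matrix_powers:
  fixes a b c :: "'k::comm_ring_1 tuv_series" and w :: "'k tuv_series ^ 3"
  defines "D \<equiv> (*v) (ad_matrix a b c)"
  shows "(D ^^ (2 * n + 1)) w = ad_eigval_sq a b c ^ n *s D w"
    and "(D ^^ (2 * n + 2)) w = ad_eigval_sq a b c ^ n *s D (D w)"
proof -
  have cubed: "D (D (D z)) = ad_eigval_sq a b c *s D z" for z
    unfolding D_def by (rule ad_matrix_cubed)
  have scale: "D (k *s z) = k *s D z" for k z
    by (simp add: D_def vec_eq_iff matrix_vector_mult_def sum_distrib_left mult_ac)
  show odd: "(D ^^ (2 * n + 1)) w = ad_eigval_sq a b c ^ n *s D w"
    by (induction n) (simp_all add: scale cubed vec_eq_iff mult_ac)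
  show "(D ^^ (2 * n + 2)) w = ad_eigval_sq a b c ^ n *s D (D w)"
    using odd by (simp add: scale)
qed

lemma mps_order_ge_ad_eigval_sq: "mps_order_ge 1 (ad_eigval_sq a b c)"
proof -
  have v: "mps_order_ge 1 (mps_var i)" for i
    by (rule mps_homogeneous_order_ge[OF mps_homogeneous_var])
  have l: "mps_order_ge 1 (f * g)" if "mps_order_ge 1 g" for f g :: "'a tuv_series"
    using mps_order_ge_mult[OF mps_order_ge_0 that] by simp
  have "ad_eigval_sq a b c = (2 * a^2) * mps_var Var_t + (4 * a * b) * mps_var Var_v + (2 * b^2) * mps_var Var_u
      + (4 * c^2 * mps_var Var_v) * mps_var Var_v + (- 4 * c^2 * mps_var Var_t) * mps_var Var_u"
    by (simp add: ad_eigval_sq_def Let_def power2_eq_square algebra_simps)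
  then show ?thesis
    by (simp only:) (intro mps_order_ge_add l v)
qed

text \<open>
  A series without constant term can be substituted into any power series in one variable.
\<close>

lemma mps_sums_power_series:
  assumes "mps_order_ge 1 w"
  shows "mps_sums (\<lambda>n. mps_const (d n) * w ^ n) (mps_suminf (\<lambda>n. mps_const (d n) * w ^ n))"
proof (rule mps_sums_suminf)
  show "mps_order_ge n (mps_const (d n) * w ^ n)" for n
    using mps_order_ge_mult[OF mps_order_ge_0 mps_order_ge_power[OF assms]] by simp
qed

definition exp_ad_matrix ::
  "'k::field_char_0 tuv_series \<Rightarrow> 'k tuv_series \<Rightarrow> 'k tuv_series \<Rightarrow> 'k tuv_series ^ 3 ^ 3" where
  "exp_ad_matrix a b c = mat 1 + mat (sinhc_sqrt (ad_eigval_sq a b c)) ** ad_matrix a b c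
     + mat (coshc_sqrt (ad_eigval_sq a b c)) ** (ad_matrix a b c ** ad_matrix a b c)"

text \<open>
  As $M^{2n+1} = g^n M$ and $M^{2n+2} = g^n M^2$, the odd terms of the exponential series sum to
  $A(X) M$ and the even ones, after the constant term, to $B(X) M^2$.
\<close>

lemma exp_ad_matrix_sums:
  fixes w :: "'k::field_char_0 tuv_series ^ 3"
  shows "mps_sums (\<lambda>n. mps_const (1 / fact n) * (((*v) (ad_matrix a b c) ^^ n) w $ i))
    ((exp_ad_matrix a b c *v w) $ i)"
proof -
  define D where "D = (*v) (ad_matrix a b c)"
  define g where "g = ad_eigval_sq a b c"
  let ?f = "\<lambda>n. mps_const (1 / fact n) * ((D ^^ n) w $ i)"
  have g: "mps_order_ge 1 g"
    unfolding g_def by (rule mps_order_ge_ad_eigval_sq)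
  have "mps_sums (\<lambda>n. mps_const (1 / fact (2 * n + 1)) * g ^ n * (D w $ i)) (sinhc_sqrt g * (D w $ i))"
    unfolding sinhc_sqrt_def by (intro mps_sums_mult mps_sums_power_series g)
  then have odd: "mps_sums (\<lambda>n. ?f (2 * n + 1)) (sinhc_sqrt g * (D w $ i))"
    unfolding D_def g_def ad_matrix_powers by (simp add: mult.assoc)
  have "mps_sums (\<lambda>n. mps_const (1 / fact (2 * n + 2)) * g ^ n * (D (D w) $ i)) (coshc_sqrt g * (D (D w) $ i))"
    unfolding coshc_sqrt_def by (intro mps_sums_mult mps_sums_power_series g)
  then have "mps_sums (\<lambda>n. ?f (2 * n + 2)) (coshc_sqrt g * (D (D w) $ i))"
    unfolding D_def g_def ad_matrix_powers by (simp add: mult.assoc)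
  then have "mps_sums (\<lambda>n. ?f (2 * Suc n)) (coshc_sqrt g * (D (D w) $ i))"
    by simp
  then have even: "mps_sums (\<lambda>n. ?f (2 * n)) (?f (2 * 0) + coshc_sqrt g * (D (D w) $ i))"
    by (rule mps_sums_Suc)
  have "(exp_ad_matrix a b c *v w) $ i = ?f (2 * 0) + coshc_sqrt g * (D (D w) $ i) + sinhc_sqrt g * (D w $ i)"
    by (simp add: exp_ad_matrix_def g_def D_def matrix_vector_mult_add_rdistrib mat_vector_mult
        flip: matrix_vector_mul_assoc)
  with mps_sums_even_odd[OF even odd] show ?thesis
    by (simp add: D_def)
qed

lemma ad_funpow_of_coords:
  "(ad (lin_comb a b c) ^^ n) (of_coords w) = of_coords (((*v) (ad_matrix a b c) ^^ n) w)"
  by (induction n) (simp_all add: ad_of_coords)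

text \<open>
  The embedding is continuous, so the exponential series may be summed in the coordinates. The
  formula holds exactly on the completion, before any truncation.
\<close>

lemma exp_ad_of_coords:
  "exp_ad (lin_comb a b c) (of_coords w) = of_coords (exp_ad_matrix a b c *v w)"
proof -
  let ?w = "\<lambda>n. ((*v) (ad_matrix a b c) ^^ n) w"
  let ?s = "exp_ad_matrix a b c *v w"
  have "mps_suminf (\<lambda>n. mps_const (1 / fact n) * (of_coords (?w n) $ i $ j)) = of_coords ?s $ i $ j" for i j
  proof (rule mps_sums_unique)
    have "mps_sums (\<lambda>n. tuv_embed (mps_const (1 / fact n) * (?w n $ k)) * h) (tuv_embed (?s $ k) * h)" for k h
      by (intro mps_sums_mult mps_sums_tuv_embed exp_ad_matrix_sums)
    then have "mps_sums (\<lambda>n. of_coords (\<chi> k. mps_const (1 / fact n) * (?w n $ k)) $ i $ j) (of_coords ?s $ i $ j)"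
      unfolding lin_comb_nth vec_lambda_beta by (intro mps_sums_add)
    then show "mps_sums (\<lambda>n. mps_const (1 / fact n) * (of_coords (?w n) $ i $ j)) (of_coords ?s $ i $ j)"
      by (simp add: lin_comb_nth tuv_embed_mult tuv_embed_const algebra_simps)
  qed
  then show ?thesis
    by (simp add: exp_ad_def ad_funpow_of_coords vec_eq_iff)
qed

lemma matrix_vector_axis_nth: "(S *v axis j 1) $ i = S $ i $ j"
  for S :: "'a::comm_ring_1 ^ 'n ^ 'm"
  by (simp add: matrix_vector_mult_def axis_def if_distrib[of "\<lambda>y. _ * y"] cong: if_cong)

text \<open>
  Linear independence makes the coordinates of the images unique, as the definite description in
  \<^const>\<open>assoc_matrix\<close> requires.
\<close>

lemma assoc_matrix_eqI:
  fixes S :: "'k::field_char_0 tuv_series ^ 3 ^ 3"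
  assumes "\<And>w. \<delta> (of_coords w) = of_coords (S *v w)"
  shows "assoc_matrix \<delta> = S"
proof -
  note gens = assms[of "axis 1 1", unfolded of_coords_axis] assms[of "axis 2 1", unfolded of_coords_axis]
    assms[of "axis 3 1", unfolded of_coords_axis]
  have "is_assoc_matrix \<delta> S' \<longleftrightarrow> S' = S" for S'
    unfolding is_assoc_matrix_def gens matrix_vector_axis_nth lin_comb_inject
    by (auto simp: vec_eq_iff forall_3)
  then show ?thesis
    by (simp add: assoc_matrix_def)
qed

text \<open>
  The quotient does not see coordinates of high order, so an associated matrix there is determined
  only up to the stated orders, row by row: the last row consists of the coordinates at $[x,y]$.
\<close>

lemma is_assoc_matrix_mod_iff:
  fixes F :: "'k::field_char_0 tuv_series ^ 3 ^ 3"
  assumes "\<And>w. \<delta> (of_coords w) = of_coords (F *v w)"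
  shows "is_assoc_matrix_mod (r + 1) \<delta> S \<longleftrightarrow>
    (\<forall>j. S $ 1 $ j - F $ 1 $ j \<in> aug_power ((r + 1) div 2) \<and>
         S $ 2 $ j - F $ 2 $ j \<in> aug_power ((r + 1) div 2) \<and>
         S $ 3 $ j - F $ 3 $ j \<in> aug_power (r div 2))"
proof -
  note gens = assms[of "axis 1 1", unfolded of_coords_axis] assms[of "axis 2 1", unfolded of_coords_axis]
    assms[of "axis 3 1", unfolded of_coords_axis]
  have sym: "mps_order_ge n (f - g) \<longleftrightarrow> mps_order_ge n (g - f)" for n and f g :: "'k tuv_series"
    by (auto simp: mps_order_ge_def)
  show ?thesis
    unfolding is_assoc_matrix_mod_def gens matrix_vector_axis_nth lin_comb_diff
      lin_comb_in_omega_W_hat_iff aug_power_iff_order_ge forall_3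
    by (simp add: sym[of _ "F $ _ $ _" "S $ _ $ _"])
qed

theorem corollary8:
  fixes r :: nat
    and a b c t u v g :: "'k::field_char_0 tuv_series"
    and X :: "'k gen_matrix"
    and M F :: "'k tuv_series ^ 3 ^ 3"
  assumes "3 \<le> r"
    and "t = mps_var Var_t" and "u = mps_var Var_u" and "v = mps_var Var_v"
    and "X = lin_comb a b c"
    and "g = 2 * (a^2 * t + 2 * a * b * v + b^2 * u + 2 * c^2 * (v^2 - t * u))"
    and "M = vector [vector [- 2 * c * v, - 2 * c * u, 2 * (a * v + b * u)],
                     vector [2 * c * t, 2 * c * v, - 2 * (a * t + b * v)],
                     vector [b, - a, 0]]"
    and "F = mat 1 + mat (sinhc_sqrt g) ** M + mat (coshc_sqrt g) ** (M ** M)"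
  shows "assoc_matrix (ad X) = M \<and>
    mat3_cong ((r + 1) div 2) (assoc_matrix (exp_ad X)) F \<and>
    (\<forall>S. mat3_cong ((r + 1) div 2) S F \<longrightarrow> is_assoc_matrix_mod (r + 1) (exp_ad X) S) \<and>
    (\<forall>S. is_assoc_matrix_mod (r + 1) (exp_ad X) S \<longrightarrow>
       (\<forall>j. S $ 1 $ j - F $ 1 $ j \<in> aug_power ((r + 1) div 2) \<and>
            S $ 2 $ j - F $ 2 $ j \<in> aug_power ((r + 1) div 2) \<and>
            S $ 3 $ j - F $ 3 $ j \<in> aug_power (r div 2)))"
proof -
  have M: "M = ad_matrix a b c"
    by (simp add: assms ad_matrix_def Let_def)
  have "g = ad_eigval_sq a b c"
    by (simp add: assms ad_eigval_sq_def Let_def)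
  then have F: "F = exp_ad_matrix a b c"
    unfolding exp_ad_matrix_def by (simp only: assms(8) M)
  have exp: "exp_ad X (of_coords w) = of_coords (F *v w)" for w
    unfolding F assms(5) by (rule exp_ad_of_coords)
  have "assoc_matrix (ad X) = M"
    unfolding M assms(5) by (rule assoc_matrix_eqI) (rule ad_of_coords)
  moreover have "mat3_cong ((r + 1) div 2) (assoc_matrix (exp_ad X)) F"
    by (simp add: assoc_matrix_eqI[OF exp] mat3_cong_def aug_power_iff_order_ge)
  moreover have "is_assoc_matrix_mod (r + 1) (exp_ad X) S" if "mat3_cong ((r + 1) div 2) S F" for S
  proof -
    have "S $ i $ j - F $ i $ j \<in> aug_power ((r + 1) div 2)" for i j
      using that by (simp add: mat3_cong_def)
    moreover from this have "S $ i $ j - F $ i $ j \<in> aug_power (r div 2)" for i j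
      unfolding aug_power_iff_order_ge by (rule mps_order_ge_mono) (simp add: div_le_mono)
    ultimately show ?thesis
      unfolding is_assoc_matrix_mod_iff[OF exp] by blast
  qed
  ultimately show ?thesis
    unfolding is_assoc_matrix_mod_iff[OF exp] by blast
qed

end
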